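(* Let $\mathcal T$ be a triangulation of $\triangle_{d-1}\times\triangle_{n-1}$ and let $A\in\{-1,+1\}^{d\times n}$ be a sign matrix with rows indexed by $\mathsf R$ ($|\mathsf R|=d$) and columns indexed by $\mathsf E$ ($|\mathsf E|=n$). Let $V=\overline{\mathsf R}\cup\mathsf E$ be the ordered set of size $d+n$ in which $\overline{\mathsf R}$, a copy of $\mathsf R$, precedes $\mathsf E$. Let $\chi_1$ be the chirotope on $V$ of rank $d$ induced by the pointed polyhedral matching field $(M_\sigma)$ of $\mathcal T$ on $\mathsf R\sqcup V$ together with the sign matrix $(I_{d,d}\mid A)$, and let $\chi_2$ be the chirotope on $V$ of rank $n$ induced by the pointed polyhedral matching field $(N_\sigma)$ on $\overline{\mathsf E}\sqcup V$, obtained from $\mathcal T$ by swapping the two factors of the product of simplices, together with the sign matrix $(-A^{\top}\mid I_{n,n})$, where $\overline{\mathsf E}$ is a copy of $\mathsf E$. Then $\chi_1$ and $\chi_2$ describe a dual pair of oriented matroids.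
   Context: All sets $\mathsf R,\mathsf E$ are totally ordered, and copies inherit the order. **Trees of a triangulation.** $\triangle_{k-1}=\operatorname{conv}\{\mathbf e_1,\dots,\mathbf e_k\}$. A triangulation of $\triangle_{d-1}\times\triangle_{n-1}$ is a collection of full-dimensional simplices with vertices among the $(\mathbf e_i,\mathbf e_j)$, with union $\triangle_{d-1}\times\triangle_{n-1}$, any two intersecting in a common face. Identifying $(\mathbf e_i,\mathbf e_j)$ with the edge $(i,j)$ of $K_{\mathsf R,\mathsf E}$, each simplex becomes a spanning tree of $K_{\mathsf R,\mathsf E}$. **The two pointed matching fields.** To each tree of $\mathcal T$ add the copies $\overline{\mathsf R}$ of the nodes of $\mathsf R$ together with an edge from each $r\in\mathsf R$ to its copy $\bar r$; this gives trees on $\mathsf R\sqcup V$. For each $d$-subset $\sigma\subseteq V$, $M_\sigma$ is the unique perfect matching between $\mathsf R$ and $\sigma$ contained in some of these extended trees. Similarly, view each tree of $\mathcal T$ as a tree on $\overline{\mathsf E}\sqcup\overline{\mathsf R}$ by replacing each edge $(i,j)$, $i\in\mathsf R$, $j\in\mathsf E$, by $(\bar j,\bar i)$, and add the nodes of $\mathsf E$ with an edge from each $\bar j\in\overline{\mathsf E}$ to $j\in\mathsf E$; for each $n$-subset $\sigma\subseteq V$, $N_\sigma$ is the unique perfect matching between $\overline{\mathsf E}$ and $\sigma$ contained in some of these extended trees. **Induced chirotope.** For a matching field $(M_\sigma)$ between an ordered set $Q$ and the subsets $\sigma$ of $V$ with $|\sigma|=|Q|$, and a sign matrix $B$ with rows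 indexed by $Q$ and columns indexed by $V$, the induced map is $\sigma\mapsto\operatorname{sign}(M_\sigma)\prod_{e\in M_\sigma}B_e$, extended to an alternating map via $\chi(\sigma)=\chi(\sigma_1,\sigma_2,\dots)$ for $\sigma=\{\sigma_1<\sigma_2<\cdots\}$; $\operatorname{sign}(M_\sigma)$ is the sign of the permutation obtained from the bijection $Q\to\sigma$ given by $M_\sigma$ after identifying $Q$ and $\sigma$ with $\{1,\dots,|Q|\}$ in an order-preserving way. For the two pairs in the claim these maps are known to be chirotopes of uniform oriented matroids (a chirotope determines an oriented matroid up to global sign). **Duality.** Two chirotopes $\chi:V^d\to\{+,-,0\}$ and $\chi':V^n\to\{+,-,0\}$ of uniform oriented matroids of ranks $d$ and $n$ on a ground set $V$ of size $d+n$ are dual if and only if for each ordering $(x_1,\dots,x_{d+n})$ of $V$ one has $\chi(x_1,\dots,x_d)\cdot\chi'(x_{d+1},\dots,x_{d+n})=\operatorname{sign}(x_1,\dots,x_{d+n})$, the sign of the permutation represented by the ordering. *)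

theory Defs
  imports "HOL-Analysis.Analysis"
begin

text \<open>
  The ordered sets \<open>R\<close> and \<open>E\<close> are the universes of two finite linearly ordered types
  \<open>'r\<close> and \<open>'e\<close>, and the ground set \<open>V\<close>, a copy of \<open>R\<close> followed by \<open>E\<close>, is the universe of
  \<open>'r + 'e\<close> under the ordinal-sum order: \<open>Inl r\<close> is the copy of \<open>r\<close>, and every \<open>Inl\<close> precedes
  every \<open>Inr\<close>. Signs are the integers \<open>-1\<close>, \<open>0\<close>, \<open>1\<close>.
\<close>

instantiation sum :: (linorder, linorder) linorder
begin

definition less_eq_sum :: "'a + 'b \<Rightarrow> 'a + 'b \<Rightarrow> bool" where
  "less_eq_sum x y \<longleftrightarrow>
     (case x of Inl a \<Rightarrow> (case y of Inl a' \<Rightarrow> a \<le> a' | Inr _ \<Rightarrow> True)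
              | Inr b \<Rightarrow> (case y of Inl _ \<Rightarrow> False | Inr b' \<Rightarrow> b \<le> b'))"

definition less_sum :: "'a + 'b \<Rightarrow> 'a + 'b \<Rightarrow> bool" where
  "less_sum x y \<longleftrightarrow>
     (case x of Inl a \<Rightarrow> (case y of Inl a' \<Rightarrow> a < a' | Inr _ \<Rightarrow> True)
              | Inr b \<Rightarrow> (case y of Inl _ \<Rightarrow> False | Inr b' \<Rightarrow> b < b'))"

instance
  by standard (auto simp: less_eq_sum_def less_sum_def split: sum.splits)

end


section \<open>Triangulations of a product of two simplices\<close>

definition unit_simplex :: "(real ^ 'k::finite) set" where
  "unit_simplex = convex hull (range (\<lambda>i. axis i 1))"

definition product_vertex :: "'r::finite \<Rightarrow> 'e::finite \<Rightarrow> (real ^ 'r) \<times> (real ^ 'e)" where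
  "product_vertex i j = (axis i 1, axis j 1)"

definition product_triangulation ::
    "((real ^ 'r::finite) \<times> (real ^ 'e::finite)) set set \<Rightarrow> bool" where
  "product_triangulation T \<longleftrightarrow>
     triangulation T \<and>
     \<Union>T = unit_simplex \<times> unit_simplex \<and>
     (\<forall>S\<in>T. aff_dim S = aff_dim (unit_simplex \<times> unit_simplex :: ((real ^ 'r) \<times> (real ^ 'e)) set) \<and>
            {v. v extreme_point_of S} \<subseteq> {product_vertex i j | i j. True})"

definition simplex_tree :: "((real ^ 'r::finite) \<times> (real ^ 'e::finite)) set \<Rightarrow> ('r \<times> 'e) set" where
  "simplex_tree S = {(i, j). product_vertex i j extreme_point_of S}"


section \<open>The two pointed matching fields\<close>

text \<open>
  Edges of a bipartite graph between \<open>Q\<close> and \<open>V\<close> are pairs in \<open>'q \<times> 'v\<close>, so the two colour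
  classes are disjoint by construction. Thus \<open>Q = R\<close> below is distinct from its copy in
  \<open>V = 'r + 'e\<close>, and for the second matching field the copy of \<open>E\<close> outside \<open>V\<close> is simply \<open>'e\<close>
  in the first component.
\<close>

definition pointed_tree :: "('r \<times> 'e) set \<Rightarrow> ('r \<times> ('r + 'e)) set" where
  "pointed_tree F = {(r, Inl r) | r. True} \<union> {(i, Inr j) | i j. (i, j) \<in> F}"

definition swapped_pointed_tree :: "('r \<times> 'e) set \<Rightarrow> ('e \<times> ('r + 'e)) set" where
  "swapped_pointed_tree F = {(j, Inl i) | i j. (i, j) \<in> F} \<union> {(j, Inr j) | j. True}"

definition perfect_matching :: "'q set \<Rightarrow> 'v set \<Rightarrow> ('q \<times> 'v) set \<Rightarrow> bool" where
  "perfect_matching Q \<sigma> M \<longleftrightarrow>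
     M \<subseteq> Q \<times> \<sigma> \<and> (\<forall>q\<in>Q. \<exists>!v. (q, v) \<in> M) \<and> (\<forall>v\<in>\<sigma>. \<exists>!q. (q, v) \<in> M)"

text \<open>Only the values at sets \<open>\<sigma>\<close> with \<open>card \<sigma> = CARD('q)\<close> are meaningful.\<close>

definition matching_field :: "('q \<times> 'v) set set \<Rightarrow> 'v set \<Rightarrow> ('q \<times> 'v) set" where
  "matching_field \<F> \<sigma> = (THE M. perfect_matching UNIV \<sigma> M \<and> (\<exists>F\<in>\<F>. M \<subseteq> F))"

definition pointed_matching_field ::
    "((real ^ 'r::finite) \<times> (real ^ 'e::finite)) set set \<Rightarrow> ('r + 'e) set \<Rightarrow> ('r \<times> ('r + 'e)) set"
  where
  "pointed_matching_field T = matching_field ((\<lambda>S. pointed_tree (simplex_tree S)) ` T)"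

definition swapped_pointed_matching_field ::
    "((real ^ 'r::finite) \<times> (real ^ 'e::finite)) set set \<Rightarrow> ('r + 'e) set \<Rightarrow> ('e \<times> ('r + 'e)) set"
  where
  "swapped_pointed_matching_field T =
     matching_field ((\<lambda>S. swapped_pointed_tree (simplex_tree S)) ` T)"


section \<open>The induced chirotope\<close>

text \<open>
  The sign of a list \<open>xs\<close> without repetitions, as an ordering of \<open>set xs\<close>: the sign of the
  permutation sending each position \<open>i\<close> to the position of \<open>xs ! i\<close> in increasing order.
\<close>

definition ordering_sign :: "'v::linorder list \<Rightarrow> int" where
  "ordering_sign xs =
     sign (THE \<pi>. \<pi> permutes {..<length xs} \<and>
                  (\<forall>i<length xs. xs ! i = sorted_list_of_set (set xs) ! \<pi> i))"

text \<open>
  Listing the partners of \<open>q\<^sub>1 < q\<^sub>2 < \<dots>\<close> in this order, the position of the partner of \<open>q\<^sub>i\<close> in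
  increasing order is the image of \<open>i\<close> under the permutation given by the matching.
\<close>

definition matching_sign :: "('q::{finite,linorder} \<times> 'v::linorder) set \<Rightarrow> int" where
  "matching_sign M = ordering_sign (map (\<lambda>q. THE v. (q, v) \<in> M) (sorted_list_of_set UNIV))"

text \<open>
  Tuples are lists; a map on \<open>V\<^sup>r\<close> is a map on lists of which only the values at lists of
  length \<open>r\<close> matter, with \<open>r = CARD('q)\<close> in the following definition. The factor
  \<open>ordering_sign xs\<close> is the alternating extension from increasing tuples.
\<close>

definition induced_chirotope ::
    "('v set \<Rightarrow> ('q \<times> 'v) set) \<Rightarrow> int ^ 'v::{finite,linorder} ^ 'q::{finite,linorder}
       \<Rightarrow> 'v list \<Rightarrow> int" where
  "induced_chirotope M B xs =
     (if distinct xs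
      then ordering_sign xs * (matching_sign (M (set xs)) * (\<Prod>(q, v)\<in>M (set xs). B $ q $ v))
      else 0)"

definition hcat :: "'a ^ 'c ^ 'q \<Rightarrow> 'a ^ 'd ^ 'q \<Rightarrow> 'a ^ ('c::finite + 'd::finite) ^ 'q" where
  "hcat X Y = (\<chi> q v. case v of Inl c \<Rightarrow> X $ q $ c | Inr d \<Rightarrow> Y $ q $ d)"


section \<open>Chirotopes and duality\<close>

text \<open>The last conjunct is the family of Grassmann--Pluecker relations.\<close>

definition chirotope :: "nat \<Rightarrow> ('v list \<Rightarrow> int) \<Rightarrow> bool" where
  "chirotope r \<phi> \<longleftrightarrow>
     (\<forall>xs. length xs = r \<longrightarrow> \<phi> xs \<in> {-1, 0, 1}) \<and>
     (\<exists>xs. length xs = r \<and> \<phi> xs \<noteq> 0) \<and>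
     (\<forall>xs \<pi>. length xs = r \<and> \<pi> permutes {..<r} \<longrightarrow> \<phi> (permute_list \<pi> xs) = sign \<pi> * \<phi> xs) \<and>
     (\<forall>xs ys. Suc (length xs) = r \<and> length ys = Suc r \<longrightarrow>
        (let t = (\<lambda>k. (-1) ^ k * \<phi> (xs @ [ys ! k]) * \<phi> (take k ys @ drop (Suc k) ys))
         in (\<forall>k\<le>r. t k = 0) \<or> ((\<exists>k\<le>r. t k > 0) \<and> (\<exists>k\<le>r. t k < 0))))"

definition uniform_chirotope :: "nat \<Rightarrow> ('v list \<Rightarrow> int) \<Rightarrow> bool" where
  "uniform_chirotope r \<phi> \<longleftrightarrow>
     chirotope r \<phi> \<and> (\<forall>xs. length xs = r \<and> distinct xs \<longrightarrow> \<phi> xs \<noteq> 0)"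

definition dual_uniform_chirotopes ::
    "nat \<Rightarrow> nat \<Rightarrow> ('v::{finite,linorder} list \<Rightarrow> int) \<Rightarrow> ('v list \<Rightarrow> int) \<Rightarrow> bool" where
  "dual_uniform_chirotopes d n \<phi> \<psi> \<longleftrightarrow>
     CARD('v) = d + n \<and> uniform_chirotope d \<phi> \<and> uniform_chirotope n \<psi> \<and>
     (\<forall>xs. distinct xs \<and> set xs = UNIV \<longrightarrow> \<phi> (take d xs) * \<psi> (drop d xs) = ordering_sign xs)"

end

theory Submission
  imports Defs
begin

text \<open>
  A weighting of the edges of a tree of the triangulation is, up to scaling, the barycentric
  coordinates of a point in the corresponding simplex, and its marginals are the coordinates of that
  point. So every pair of marginals with equal totals is realised by exactly one weighting, which is
  integral because the trees are forests. Marginals in \<open>{0, 1}\<close> give the matching fields. Marginals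
  that are 2 on \<open>S\<close> and on the rows and 1 on four further elements \<open>a, b, c, d\<close> give, after a proper
  2-colouring of the edges, two matchings in a common tree; exchanging them along an alternating path
  shows that two of the three terms of the corresponding Grassmann--Pluecker relation cancel. For a
  uniform map the three-term relations imply all others.

  For duality, the matchings of a set and of its complement use the same matching \<open>\<mu>\<close> of the trees,
  and listing the partners of all rows and then of all columns applies to the increasing ordering
  of \<open>V\<close> the product of the disjoint transpositions along \<open>\<mu>\<close>. Its sign cancels against the signs
  of \<open>- transpose A\<close>.
\<close>

text \<open>The common tree of two matchings is found for only one of the three ways to split
  \<open>a, b, c, d\<close> into pairs, and the construction does not control which one. Nor is it
  known where the alternating path ends. Neither matters: whichever splitting occurs, its term
  cancels against one of the other two, which already excludes that the three terms of the relation
  agree.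

  The argument moves between two descriptions of the map. On ordered tuples a matching is a
  permutation and the value is a single term of a determinant expansion, so exchanges are easy to
  compute there. On sets, complements and circuits are available, as the passage from three-term to
  general relations needs. The sign lemmas translate between the two.

  Both matching fields are instances of one construction: swapping the factors of the product
  reverses the edges of every tree and exchanges the roles of the two summands of \<open>V\<close>.
  Hence uniformity is proved once, for an abstract family of forests.\<close>

section \<open>Weighted bipartite forests\<close>

text \<open>Acyclicity in the form used by induction: every nonempty set of edges contains one that
  ends in a leaf, so edges can be peeled off one at a time.\<close>

definition bipartite_forest :: "('a \<times> 'b) set \<Rightarrow> bool" where
  "bipartite_forest F \<longleftrightarrow>
     (\<forall>G\<subseteq>F. G \<noteq> {} \<longrightarrow>
        (\<exists>x y. (x, y) \<in> G \<and> ((\<forall>y'. (x, y') \<in> G \<longrightarrow> y' = y) \<or> (\<forall>x'. (x', y) \<in> G \<longrightarrow> x' = x))))"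

text \<open>Polymorphic in the weights: real weights are scaled barycentric coordinates, natural
  weights are edge multiplicities with prescribed degrees.\<close>

definition transport ::
    "('a::finite \<times> 'b::finite) set \<Rightarrow> ('a \<Rightarrow> 'c::{ordered_comm_monoid_add}) \<Rightarrow> ('b \<Rightarrow> 'c) \<Rightarrow> ('a \<times> 'b \<Rightarrow> 'c) \<Rightarrow> bool" where
  "transport F a b l \<longleftrightarrow>
     (\<forall>e. 0 \<le> l e) \<and> (\<forall>e. e \<notin> F \<longrightarrow> l e = 0) \<and>
     (\<forall>x. (\<Sum>y\<in>UNIV. l (x, y)) = a x) \<and> (\<forall>y. (\<Sum>x\<in>UNIV. l (x, y)) = b y)"

lemma bipartite_forest_mono: "bipartite_forest F \<Longrightarrow> G \<subseteq> F \<Longrightarrow> bipartite_forest G"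
  unfolding bipartite_forest_def by (meson order_trans)

lemma bipartite_forest_leaf:
  assumes "bipartite_forest F" "F \<noteq> {}"
  obtains x y where "(x, y) \<in> F"
    "(\<forall>y'. (x, y') \<in> F \<longrightarrow> y' = y) \<or> (\<forall>x'. (x', y) \<in> F \<longrightarrow> x' = x)"
  using assms(1)[unfolded bipartite_forest_def, rule_format, OF order_refl assms(2)] by blast

lemma bipartite_forest_converse:
  assumes "bipartite_forest F" shows "bipartite_forest (F\<inverse>)"
  unfolding bipartite_forest_def
proof (intro allI impI)
  fix G :: "('b \<times> 'a) set" assume "G \<subseteq> F\<inverse>" "G \<noteq> {}"
  then have G: "G\<inverse> \<subseteq> F" "G\<inverse> \<noteq> {}" by auto
  obtain x y where "(x, y) \<in> G\<inverse>"
     "(\<forall>y'. (x, y') \<in> G\<inverse> \<longrightarrow> y' = y) \<or> (\<forall>x'. (x', y) \<in> G\<inverse> \<longrightarrow> x' = x)"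
    by (rule bipartite_forest_leaf[OF bipartite_forest_mono[OF assms G(1)] G(2)])
  then show "\<exists>y x. (y, x) \<in> G \<and> ((\<forall>x'. (y, x') \<in> G \<longrightarrow> x' = x) \<or> (\<forall>y'. (y', x) \<in> G \<longrightarrow> y' = y))"
    unfolding converse_iff by (intro exI[of _ y] exI[of _ x]) (simp only: disj_commute simp_thms)
qed

lemma sum_fun_upd_zero:
  fixes l :: "'a::finite \<times> 'b::finite \<Rightarrow> 'c::ab_group_add"
  shows "(\<Sum>y\<in>UNIV. (l(e := 0)) (x, y)) = (\<Sum>y\<in>UNIV. l (x, y)) - (if x = fst e then l e else 0)"
    and "(\<Sum>x\<in>UNIV. (l(e := 0)) (x, y)) = (\<Sum>x\<in>UNIV. l (x, y)) - (if y = snd e then l e else 0)"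
proof -
  have "(\<Sum>y\<in>UNIV. (l(e := 0)) (x, y)) = (\<Sum>y\<in>UNIV. l (x, y) - (if y = snd e then (if x = fst e then l e else 0) else 0))"
    by (intro sum.cong) (auto simp: prod_eq_iff)
  then show "(\<Sum>y\<in>UNIV. (l(e := 0)) (x, y)) = (\<Sum>y\<in>UNIV. l (x, y)) - (if x = fst e then l e else 0)"
    by (simp add: sum_subtractf)
  have "(\<Sum>x\<in>UNIV. (l(e := 0)) (x, y)) = (\<Sum>x\<in>UNIV. l (x, y) - (if x = fst e then (if y = snd e then l e else 0) else 0))"
    by (intro sum.cong) (auto simp: prod_eq_iff)
  then show "(\<Sum>x\<in>UNIV. (l(e := 0)) (x, y)) = (\<Sum>x\<in>UNIV. l (x, y)) - (if y = snd e then l e else 0)"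
    by (simp add: sum_subtractf)
qed

text \<open>The edge at a leaf carries the whole sum of that leaf, which is an integer. Setting its
  weight to zero changes the two sums concerned by integers, so the smaller forest can be treated in
  the same way.\<close>

lemma forest_weights_integral:
  fixes l :: "'a::finite \<times> 'b::finite \<Rightarrow> real"
  assumes "bipartite_forest F" "\<And>e. e \<notin> F \<Longrightarrow> l e = 0"
    and "\<And>x. (\<Sum>y\<in>UNIV. l (x, y)) \<in> \<int>" "\<And>y. (\<Sum>x\<in>UNIV. l (x, y)) \<in> \<int>"
  shows "l e \<in> \<int>"
proof -
  have "finite F" by simp
  then show ?thesis using assms
  proof (induction "card F" arbitrary: F l e)
    case 0
    then show ?case by simp
  next
    case (Suc n)
    then have "F \<noteq> {}" by auto
    with Suc.prems(2) obtain x y where xy: "(x, y) \<in> F"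
      and leaf: "(\<forall>y'. (x, y') \<in> F \<longrightarrow> y' = y) \<or> (\<forall>x'. (x', y) \<in> F \<longrightarrow> x' = x)"
      using bipartite_forest_leaf by metis
    have int: "l (x, y) \<in> \<int>"
      using leaf
    proof
      assume *: "\<forall>y'. (x, y') \<in> F \<longrightarrow> y' = y"
      have "(\<Sum>z\<in>UNIV. l (x, z)) = (\<Sum>z\<in>UNIV. if z = y then l (x, y) else 0)"
        by (intro sum.cong) (use * Suc.prems(3) in auto)
      then show ?thesis using Suc.prems(4)[of x] by simp
    next
      assume *: "\<forall>x'. (x', y) \<in> F \<longrightarrow> x' = x"
      have "(\<Sum>z\<in>UNIV. l (z, y)) = (\<Sum>z\<in>UNIV. if z = x then l (x, y) else 0)"
        by (intro sum.cong) (use * Suc.prems(3) in auto)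
      then show ?thesis using Suc.prems(5)[of y] by simp
    qed
    define l' where "l' = l((x, y) := 0)"
    have row: "(\<Sum>z\<in>UNIV. l' (u, z)) = (\<Sum>z\<in>UNIV. l (u, z)) - (if u = x then l (x, y) else 0)" for u
      unfolding l'_def sum_fun_upd_zero by simp
    have col: "(\<Sum>z\<in>UNIV. l' (z, u)) = (\<Sum>z\<in>UNIV. l (z, u)) - (if u = y then l (x, y) else 0)" for u
      unfolding l'_def sum_fun_upd_zero by simp
    have "l' e \<in> \<int>"
    proof (rule Suc.hyps(1)[of "F - {(x, y)}"])
      show "n = card (F - {(x, y)})" using Suc.hyps(2) xy by simp
      show "bipartite_forest (F - {(x, y)})" using Suc.prems(2) bipartite_forest_mono by blast
      show "l' e = 0" if "e \<notin> F - {(x, y)}" for e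
        using that Suc.prems(3)[of e] by (auto simp: l'_def)
      show "(\<Sum>z\<in>UNIV. l' (u, z)) \<in> \<int>" for u
        unfolding row using int Suc.prems(4) by auto
      show "(\<Sum>z\<in>UNIV. l' (z, u)) \<in> \<int>" for u
        unfolding col using int Suc.prems(5) by auto
    qed simp
    then show ?case using int by (auto simp: l'_def split: if_splits)
  qed
qed

section \<open>Barycentric coordinates in the product of two simplices\<close>

lemma affine_independent_coeffs_unique:
  fixes C :: "'a::real_vector set"
  assumes "finite C" "\<not> affine_dependent C" "sum f C = sum g C"
    and "(\<Sum>v\<in>C. f v *\<^sub>R v) = (\<Sum>v\<in>C. g v *\<^sub>R v)" and "v \<in> C"
  shows "f v = g v"
proof (rule ccontr)
  assume "f v \<noteq> g v"
  then have "sum (\<lambda>v. f v - g v) C = 0 \<and> (\<exists>v\<in>C. f v - g v \<noteq> 0) \<and> (\<Sum>v\<in>C. (f v - g v) *\<^sub>R v) = 0"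
    using assms by (auto simp: sum_subtractf scaleR_left_diff_distrib)
  then have "affine_dependent C"
    unfolding affine_dependent_explicit_finite[OF assms(1)] by (rule exI[of _ "\<lambda>v. f v - g v"])
  with assms(2) show False by contradiction
qed

lemma inj_product_vertex: "inj (\<lambda>(i, j). product_vertex i j)"
  by (auto simp: inj_def product_vertex_def axis_eq_axis)

lemma weighted_product_vertices:
  fixes l :: "'r::finite \<times> 'e::finite \<Rightarrow> real"
  shows "(\<Sum>e\<in>UNIV. l e *\<^sub>R (case e of (i, j) \<Rightarrow> product_vertex i j)) =
     ((\<chi> i. \<Sum>j\<in>UNIV. l (i, j)), (\<chi> j. \<Sum>i\<in>UNIV. l (i, j)))"
proof -
  have 1: "(\<Sum>e\<in>UNIV. l e *\<^sub>R (case e of (i, j) \<Rightarrow> product_vertex i j)) =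
     (\<Sum>i\<in>UNIV. \<Sum>j\<in>UNIV. l (i, j) *\<^sub>R product_vertex i j)"
    unfolding sum.cartesian_product UNIV_Times_UNIV by (intro sum.cong) auto
  have "(\<Sum>i\<in>UNIV. \<Sum>j\<in>UNIV. l (i, j) *\<^sub>R axis i (1::real)) $ k = (\<Sum>j\<in>UNIV. l (k, j))" for k
  proof -
    have "(\<Sum>i\<in>UNIV. \<Sum>j\<in>UNIV. l (i, j) *\<^sub>R axis i (1::real)) $ k
        = (\<Sum>i\<in>UNIV. if i = k then (\<Sum>j\<in>UNIV. l (k, j)) else 0)"
      unfolding sum_component by (intro sum.cong) (auto simp: axis_def)
    then show ?thesis by simp
  qed
  moreover have "(\<Sum>i\<in>UNIV. \<Sum>j\<in>UNIV. l (i, j) *\<^sub>R axis j (1::real)) $ k = (\<Sum>i\<in>UNIV. l (i, k))" for k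
  proof -
    have "(\<Sum>j\<in>UNIV. l (i, j) *\<^sub>R axis j (1::real)) $ k = (\<Sum>j\<in>UNIV. if j = k then l (i, k) else 0)" for i
      unfolding sum_component by (intro sum.cong) (auto simp: axis_def)
    then show ?thesis by (simp only: sum_component[of _ UNIV]) simp
  qed
  ultimately show ?thesis
    unfolding 1 unfolding product_vertex_def
    by (simp only: prod_eq_iff fst_sum snd_sum fst_scaleR snd_scaleR fst_conv snd_conv vec_eq_iff vec_lambda_beta) simp
qed

lemma mem_unit_simplexI:
  fixes a :: "real ^ 'k::finite"
  assumes "\<And>i. 0 \<le> a $ i" "(\<Sum>i\<in>UNIV. a $ i) = 1"
  shows "a \<in> unit_simplex"
proof -
  have "a = (\<Sum>i\<in>UNIV. a $ i *\<^sub>R axis i 1)"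
    by (simp add: basis_expansion[of a, unfolded scalar_mult_eq_scaleR])
  also have "\<dots> \<in> convex hull range (\<lambda>i. axis i 1)"
    by (intro convex_sum) (auto simp: assms hull_inc)
  finally show ?thesis unfolding unit_simplex_def .
qed

section \<open>The trees of a triangulation\<close>

lemma product_triangulation_simplexE:
  fixes T :: "((real ^ 'r::finite) \<times> (real ^ 'e::finite)) set set"
  assumes "product_triangulation T" "S \<in> T"
  obtains C where "finite C" "\<not> affine_dependent C" "S = convex hull C"
    "C = (\<lambda>(i, j). product_vertex i j) ` simplex_tree S"
proof -
  have "\<exists>n. n simplex S" and sub: "{v. v extreme_point_of S} \<subseteq> {product_vertex i j |i j. True}"
    using assms unfolding product_triangulation_def triangulation_def by simp_all
  then obtain C where C: "\<not> affine_dependent C" "S = convex hull C"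
    unfolding simplex_def by (elim exE conjE)
  have ext: "{v. v extreme_point_of S} = C"
    using extreme_point_of_convex_hull_affine_independent[OF C(1)] C(2) by auto
  have "v \<in> C \<longleftrightarrow> v \<in> (\<lambda>(i, j). product_vertex i j) ` simplex_tree S" for v
    using sub[THEN subsetD, of v] unfolding simplex_tree_def ext[symmetric] by (auto simp: image_iff)
  then have "C = (\<lambda>(i, j). product_vertex i j) ` simplex_tree S" by blast
  with C show thesis
    by (intro that[OF aff_independent_finite])
qed

lemma sum_product_vertices:
  fixes f :: "(real ^ 'r::finite) \<times> (real ^ 'e::finite) \<Rightarrow> 'c::comm_monoid_add"
  shows "sum f ((\<lambda>(i, j). product_vertex i j) ` F) = (\<Sum>e\<in>F. f (case e of (i, j) \<Rightarrow> product_vertex i j))"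
  using inj_product_vertex by (subst sum.reindex) (auto intro: inj_on_subset)

lemma transport_total:
  assumes "transport F a b l"
  shows "sum a UNIV = (\<Sum>e\<in>UNIV. l e)" "sum b UNIV = (\<Sum>e\<in>UNIV. l e)"
proof -
  have a: "a = (\<lambda>x. \<Sum>y\<in>UNIV. l (x, y))" and b: "b = (\<lambda>y. \<Sum>x\<in>UNIV. l (x, y))"
    using assms unfolding transport_def by auto
  show 1: "sum a UNIV = (\<Sum>e\<in>UNIV. l e)"
    unfolding a sum.cartesian_product UNIV_Times_UNIV by (intro sum.cong) auto
  show "sum b UNIV = (\<Sum>e\<in>UNIV. l e)"
    unfolding 1[symmetric] unfolding a b by (rule sum.swap)
qed

lemma sum_edges_transport:
  fixes l :: "'r::finite \<times> 'e::finite \<Rightarrow> real"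
  assumes "transport F a b l"
  shows "(\<Sum>e\<in>F. l e *\<^sub>R (case e of (i, j) \<Rightarrow> product_vertex i j)) = ((\<chi> i. a i), (\<chi> j. b j))"
proof -
  have "(\<Sum>e\<in>F. l e *\<^sub>R (case e of (i, j) \<Rightarrow> product_vertex i j))
      = (\<Sum>e\<in>UNIV. l e *\<^sub>R (case e of (i, j) \<Rightarrow> product_vertex i j))"
    by (rule sum.mono_neutral_left) (use assms in \<open>auto simp: transport_def\<close>)
  then show ?thesis
    unfolding weighted_product_vertices using assms by (simp add: transport_def)
qed

lemma transport_zero:
  fixes a :: "'a::finite \<Rightarrow> real"
  assumes "transport F a b l" "sum a UNIV = 0"
  shows "l e = 0"
proof -
  have "(\<Sum>e\<in>UNIV. l e) = 0" using transport_total(1)[OF assms(1)] assms(2) by simp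
  then show ?thesis
    using assms(1) sum_nonneg_eq_0_iff[of UNIV l] by (simp only: transport_def finite UNIV_I simp_thms)
qed

text \<open>Divided by their common total, the marginals are a point of the product of simplices.
  Its barycentric coordinates in a simplex that contains it, scaled back, are the weighting.\<close>

lemma product_triangulation_cover:
  fixes T :: "((real ^ 'r::finite) \<times> (real ^ 'e::finite)) set set"
    and a :: "'r \<Rightarrow> real" and b :: "'e \<Rightarrow> real"
  assumes T: "product_triangulation T"
    and a: "\<And>i. 0 \<le> a i" and b: "\<And>j. 0 \<le> b j" and eq: "sum a UNIV = sum b UNIV"
  shows "\<exists>S\<in>T. \<exists>l. transport (simplex_tree S) a b l"
proof (cases "sum a UNIV = 0")
  case True
  then have "a = (\<lambda>_. 0)" "b = (\<lambda>_. 0)"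
    using a b eq by (auto simp: sum_nonneg_eq_0_iff fun_eq_iff)
  then have "transport F a b (\<lambda>_. 0)" for F
    by (simp add: transport_def)
  \<comment> \<open>With total 0 no scaling is possible, but the zero weighting fits every tree; a
    simplex exists because the product to be covered is nonempty.\<close>
  moreover have "T \<noteq> {}"
  proof
    assume "T = {}"
    then have "unit_simplex \<times> unit_simplex = ({} :: ((real ^ 'r) \<times> (real ^ 'e)) set)"
      using T by (auto simp: product_triangulation_def)
    then show False by (auto simp: unit_simplex_def)
  qed
  ultimately show ?thesis by blast
next
  case False
  define N where "N = sum a UNIV"
  have N: "N > 0" using False a by (simp add: N_def order.strict_iff_order sum_nonneg)
  define p where "p = ((\<chi> i. a i / N), (\<chi> j. b j / N))"
  have "p \<in> unit_simplex \<times> unit_simplex"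
    unfolding p_def
    by (intro SigmaI mem_unit_simplexI) (use a b N eq in \<open>auto simp: N_def sum_divide_distrib[symmetric]\<close>)
  then obtain S where S: "S \<in> T" "p \<in> S"
    using T unfolding product_triangulation_def by blast
  obtain C where C: "finite C" "\<not> affine_dependent C" "S = convex hull C"
    "C = (\<lambda>(i, j). product_vertex i j) ` simplex_tree S"
    using product_triangulation_simplexE[OF T S(1)] by metis
  obtain u where u: "\<And>v. v \<in> C \<Longrightarrow> 0 \<le> u v" "(\<Sum>v\<in>C. u v *\<^sub>R v) = p"
    using S(2) unfolding C(3) convex_hull_finite[OF C(1)] by blast
  define l where "l e = (if e \<in> simplex_tree S then N * u (case e of (i, j) \<Rightarrow> product_vertex i j) else 0)" for e
  have "(\<Sum>e\<in>UNIV. l e *\<^sub>R (case e of (i, j) \<Rightarrow> product_vertex i j))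
      = (\<Sum>e\<in>simplex_tree S. l e *\<^sub>R (case e of (i, j) \<Rightarrow> product_vertex i j))"
    by (rule sum.mono_neutral_right) (auto simp: l_def)
  also have "\<dots> = N *\<^sub>R (\<Sum>v\<in>C. u v *\<^sub>R v)"
    unfolding C(4) sum_product_vertices scaleR_sum_right by (intro sum.cong) (auto simp: l_def)
  also have "\<dots> = ((\<chi> i. a i), (\<chi> j. b j))"
    using N unfolding u(2) p_def by (simp add: prod_eq_iff vec_eq_iff)
  finally have "(\<Sum>j\<in>UNIV. l (i, j)) = a i" "(\<Sum>i\<in>UNIV. l (i, j)) = b j" for i j
    unfolding weighted_product_vertices by (simp_all add: vec_eq_iff)
  moreover have "0 \<le> l e" for e
  proof (cases "e \<in> simplex_tree S")
    case True
    then have "(case e of (i, j) \<Rightarrow> product_vertex i j) \<in> C" unfolding C(4) by (rule imageI)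
    then show ?thesis using u(1) N True by (simp add: l_def)
  qed (simp add: l_def)
  moreover have "l e = 0" if "e \<notin> simplex_tree S" for e
    using that by (simp add: l_def)
  ultimately have "transport (simplex_tree S) a b l"
    unfolding transport_def by blast
  then show ?thesis using S(1) by (intro bexI exI)
qed

text \<open>A point in two simplices lies in their common face, which is spanned by common vertices.
  Affine independence then forces both coordinate vectors to be supported there and to
  agree.\<close>

lemma product_triangulation_unique:
  fixes T :: "((real ^ 'r::finite) \<times> (real ^ 'e::finite)) set set"
    and a :: "'r \<Rightarrow> real"
  assumes T: "product_triangulation T" and S: "S \<in> T" "S' \<in> T"
    and l: "transport (simplex_tree S) a b l" "transport (simplex_tree S') a b l'"
  shows "l = l'"
proof (cases "sum a UNIV = 0")
  case True
  then show ?thesis using transport_zero[OF l(1)] transport_zero[OF l(2)] by auto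
next
  case False
  define N where "N = sum a UNIV"
  have "N \<ge> 0"
    unfolding N_def transport_total(1)[OF l(1)] using l(1) by (intro sum_nonneg) (auto simp: transport_def)
  with False have N: "N > 0" by (simp add: N_def)
  define p where "p = inverse N *\<^sub>R (((\<chi> i. a i), (\<chi> j. b j)) :: (real ^ 'r) \<times> (real ^ 'e))"
  obtain C where C: "finite C" "\<not> affine_dependent C" "S = convex hull C"
    "C = (\<lambda>(i, j). product_vertex i j) ` simplex_tree S"
    using product_triangulation_simplexE[OF T S(1)] by metis
  obtain C' where C': "finite C'" "\<not> affine_dependent C'" "S' = convex hull C'"
    "C' = (\<lambda>(i, j). product_vertex i j) ` simplex_tree S'"
    using product_triangulation_simplexE[OF T S(2)] by metis
  have "P \<inter> P' face_of P" if "P \<in> T" "P' \<in> T" for P P'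
    using T that unfolding product_triangulation_def triangulation_def by simp
  from this[OF S] this[OF S(2,1)] have face: "S \<inter> S' face_of S" "S \<inter> S' face_of S'"
    by (simp_all add: Int_commute)
  obtain c where c: "c \<subseteq> C" "S \<inter> S' = convex hull c"
    using face(1) face_of_convex_hull_affine_independent[OF C(2)] C(3) by auto
  obtain c' where c': "c' \<subseteq> C'" "S \<inter> S' = convex hull c'"
    using face(2) face_of_convex_hull_affine_independent[OF C'(2)] C'(3) by auto
  \<comment> \<open>The vertices of the common face taken from either simplex are its extreme
    points, so the two choices coincide.\<close>
  have "v \<in> c \<longleftrightarrow> v extreme_point_of (S \<inter> S')" for v
    unfolding c(2) by (rule extreme_point_of_convex_hull_affine_independent[symmetric])
      (rule affine_independent_subset[OF C(2) c(1)])
  moreover have "v \<in> c' \<longleftrightarrow> v extreme_point_of (S \<inter> S')" for v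
    unfolding c'(2) by (rule extreme_point_of_convex_hull_affine_independent[symmetric])
      (rule affine_independent_subset[OF C'(2) c'(1)])
  ultimately have "c = c'" by blast
  text \<open>Both weightings are the barycentric coordinates of the same point of the common face.\<close>
  have coords: "sum g D = 1 \<and> (\<Sum>v\<in>D. g v *\<^sub>R v) = p \<and>
      (\<forall>e. k e = (if e \<in> simplex_tree R then N * g (case e of (i, j) \<Rightarrow> product_vertex i j) else 0))"
    if D: "D = (\<lambda>(i, j). product_vertex i j) ` simplex_tree R" and k: "transport (simplex_tree R) a b k"
      and g: "g = (\<lambda>v. k (inv (\<lambda>(i, j). product_vertex i j) v) / N)" for D R k g
  proof -
    have inv: "inv (\<lambda>(i, j). product_vertex i j) (case e of (i, j) \<Rightarrow> product_vertex i j) = e" for e :: "'r \<times> 'e"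
      using inv_f_f[OF inj_product_vertex, of e] .
    have "sum k (simplex_tree R) = sum k UNIV"
      by (rule sum.mono_neutral_left) (use k in \<open>auto simp: transport_def\<close>)
    then have "sum g D = 1"
      unfolding D sum_product_vertices g inv
      using transport_total(1)[OF k] N by (simp add: sum_divide_distrib[symmetric] N_def)
    moreover have "(\<Sum>v\<in>D. g v *\<^sub>R v) = p"
      unfolding D sum_product_vertices g inv p_def sum_edges_transport[OF k, symmetric]
      by (simp add: scaleR_sum_right divide_inverse mult.commute)
    moreover have "k e = (if e \<in> simplex_tree R then N * g (case e of (i, j) \<Rightarrow> product_vertex i j) else 0)" for e
      unfolding g inv using N k by (cases e) (auto simp: transport_def)
    ultimately show ?thesis by blast
  qed
  define g where "g = (\<lambda>v. l (inv (\<lambda>(i, j). product_vertex i j) v) / N)"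
  define g' where "g' = (\<lambda>v. l' (inv (\<lambda>(i, j). product_vertex i j) v) / N)"
  note g = coords[OF C(4) l(1) g_def] and g' = coords[OF C'(4) l(2) g'_def]
  have nonneg: "g v \<ge> 0" "g' v \<ge> 0" for v
    using l N by (auto simp: g_def g'_def transport_def simp del: split_paired_All)
  have "p \<in> S"
    unfolding C(3) convex_hull_finite[OF C(1)] using g nonneg by blast
  moreover have "p \<in> S'"
    unfolding C'(3) convex_hull_finite[OF C'(1)] using g' nonneg by blast
  ultimately have "p \<in> convex hull c" using c by blast
  moreover have fin: "finite c" using c(1) C(1) finite_subset by blast
  ultimately obtain u where u: "sum u c = 1" "(\<Sum>v\<in>c. u v *\<^sub>R v) = p"
    unfolding convex_hull_finite[OF fin] by blast
  \<comment> \<open>Coordinates on the common vertices, extended by zero to all vertices of either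
    simplex.\<close>
  define w where "w v = (if v \<in> c then u v else 0)" for v
  have w: "sum w D = 1 \<and> (\<Sum>v\<in>D. w v *\<^sub>R v) = p" if "c \<subseteq> D" "finite D" for D
  proof -
    have "sum w D = sum u c"
      by (rule sum.mono_neutral_cong_right) (use that in \<open>auto simp: w_def\<close>)
    moreover have "(\<Sum>v\<in>D. w v *\<^sub>R v) = (\<Sum>v\<in>c. u v *\<^sub>R v)"
      by (rule sum.mono_neutral_cong_right) (use that in \<open>auto simp: w_def\<close>)
    ultimately show ?thesis using u by simp
  qed
  have gw: "g v = w v" if "v \<in> C" for v
    by (rule affine_independent_coeffs_unique[OF C(1,2) _ _ that])
      (use g w[OF c(1) C(1)] in simp_all)
  have "g' v = w v" if "v \<in> C'" for v
    by (rule affine_independent_coeffs_unique[OF C'(1,2) _ _ that])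
      (use g' w[OF _ C'(1)] c'(1) \<open>c = c'\<close> in simp_all)
  note gw' = this
  have val: "k e = N * w (case e of (i, j) \<Rightarrow> product_vertex i j)"
    if k: "\<forall>e. k e = (if e \<in> simplex_tree R then N * f (case e of (i, j) \<Rightarrow> product_vertex i j) else 0)"
      and D: "D = (\<lambda>(i, j). product_vertex i j) ` simplex_tree R" "c \<subseteq> D"
      and f: "\<And>v. v \<in> D \<Longrightarrow> f v = w v" for k e f D R
  proof (cases "e \<in> simplex_tree R")
    case True
    then have "(case e of (i, j) \<Rightarrow> product_vertex i j) \<in> D" unfolding D(1) by (rule imageI)
    then show ?thesis using k[rule_format, of e] f True by simp
  next
    case False
    then have "(case e of (i, j) \<Rightarrow> product_vertex i j) \<notin> D"
      unfolding D(1) by (simp add: inj_image_mem_iff[OF inj_product_vertex])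
    then show ?thesis using k[rule_format, of e] D(2) False by (auto simp: w_def)
  qed
  have l_e: "l e = N * w (case e of (i, j) \<Rightarrow> product_vertex i j)" for e
    by (rule val[of l S g C e, OF _ C(4) c(1) gw]) (use g in blast)+
  have "c \<subseteq> C'" using c'(1) \<open>c = c'\<close> by simp
  then have "l' e = N * w (case e of (i, j) \<Rightarrow> product_vertex i j)" for e
    by (rule val[of l' S' g' C' e, OF _ C'(4) _ gw', rotated]) (use g' in blast)+
  with l_e have "l e = l' e" for e by simp
  then show ?thesis by (rule ext)
qed

text \<open>A set \<open>G\<close> of edges without a leaf meets each of its nodes at least twice,
  so it has at least as many edges as nodes. Linear independence of its product vertices together
  with one further vector \<open>q\<close> gives the opposite strict inequality.\<close>

lemma simplex_tree_forest:
  fixes T :: "((real ^ 'r::finite) \<times> (real ^ 'e::finite)) set set"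
  assumes T: "product_triangulation T" and S: "S \<in> T"
  shows "bipartite_forest (simplex_tree S)"
  unfolding bipartite_forest_def
proof (intro allI impI, rule ccontr)
  fix G assume G: "G \<subseteq> simplex_tree S" "G \<noteq> {}"
    and no_leaf: "\<not> (\<exists>x y. (x, y) \<in> G \<and> ((\<forall>y'. (x, y') \<in> G \<longrightarrow> y' = y) \<or> (\<forall>x'. (x', y) \<in> G \<longrightarrow> x' = x)))"
  obtain C where C: "finite C" "\<not> affine_dependent C" "S = convex hull C"
    "C = (\<lambda>(i, j). product_vertex i j) ` simplex_tree S"
    using product_triangulation_simplexE[OF T S] by metis
  define B where "B = (\<lambda>(i, j). product_vertex i j) ` G"
  have B: "\<not> affine_dependent B"
    using affine_independent_subset[OF C(2)] G(1) unfolding B_def C(4) by blast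
  define I where "I = fst ` G"
  define K where "K = snd ` G"
  \<comment> \<open>The coordinate sums of the two factors, both 1 on product vertices. The first
    turns affine into linear independence; their difference vanishes on \<open>span B\<close> but
    not at \<open>q\<close>, so \<open>q\<close> can be added to the independent set.\<close>
  define h where "h = (\<lambda>p :: (real ^ 'r) \<times> (real ^ 'e). (\<Sum>i\<in>UNIV. fst p $ i))"
  define h' where "h' = (\<lambda>p :: (real ^ 'r) \<times> (real ^ 'e). (\<Sum>j\<in>UNIV. snd p $ j))"
  have lin: "linear h" "linear h'"
    unfolding h_def h'_def by (auto intro!: linearI simp: sum.distrib sum_distrib_left)
  have hB: "h v = 1" "h' v = 1" if "v \<in> B" for v
    using that by (auto simp: B_def h_def h'_def product_vertex_def axis_def)
  have finB: "finite B" by (simp add: B_def)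
  have indep: "independent B"
  proof
    assume "dependent B"
    then obtain u where u: "\<exists>v\<in>B. u v \<noteq> 0" "(\<Sum>v\<in>B. u v *\<^sub>R v) = 0"
      unfolding dependent_finite[OF finB] by blast
    have "sum u B = (\<Sum>v\<in>B. u v *\<^sub>R h v)" using hB by simp
    also have "\<dots> = h (\<Sum>v\<in>B. u v *\<^sub>R v)"
      by (simp add: linear_sum[OF lin(1)] linear_cmul[OF lin(1)])
    also have "\<dots> = 0" unfolding u(2) by (rule linear_0[OF lin(1)])
    finally show False
      using u B affine_dependent_explicit_finite[OF finB] by blast
  qed
  obtain i0 where i0: "i0 \<in> I" using G(2) by (auto simp: I_def)
  define q :: "(real ^ 'r) \<times> (real ^ 'e)" where "q = (axis i0 1, 0)"
  have "q \<notin> span B"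
  proof
    have "subspace {p. h p = h' p}"
      by (simp add: subspace_def linear_0[OF lin(1)] linear_0[OF lin(2)] linear_add[OF lin(1)]
          linear_add[OF lin(2)] linear_cmul[OF lin(1)] linear_cmul[OF lin(2)])
    moreover have "B \<subseteq> {p. h p = h' p}" using hB by auto
    moreover assume "q \<in> span B"
    ultimately have "h q = h' q" using span_minimal by blast
    then show False by (simp add: h_def h'_def q_def axis_def)
  qed
  then have ind: "independent (insert q B)" and "q \<notin> B"
    using indep independent_insertI span_base by blast+
  define D where "D = (\<lambda>i. (axis i 1 :: real ^ 'r, 0 :: real ^ 'e)) ` I \<union> (\<lambda>j. (0 :: real ^ 'r, axis j 1 :: real ^ 'e)) ` K"
  have "insert q B \<subseteq> span D"
  proof -
    have "product_vertex i j \<in> span D" if "(i, j) \<in> G" for i j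
    proof -
      have "(axis i 1, 0) \<in> D" "(0, axis j 1) \<in> D"
        using that by (force simp: D_def I_def K_def)+
      then have "(axis i 1, 0) + (0, axis j 1) \<in> span D"
        by (intro span_add span_base)
      then show ?thesis by (simp add: product_vertex_def)
    qed
    moreover have "q \<in> span D" using i0 by (auto simp: q_def D_def intro: span_base)
    ultimately show ?thesis by (auto simp: B_def)
  qed
  then have "card (insert q B) \<le> card D"
    using independent_span_bound[of D, OF _ ind] by (simp add: D_def)
  moreover have "card D \<le> card I + card K"
    unfolding D_def by (intro card_Un_le[THEN order_trans] add_mono card_image_le) auto
  moreover have "card (insert q B) = Suc (card G)"
  proof -
    have "card B = card G"
      unfolding B_def by (intro card_image inj_on_subset[OF inj_product_vertex]) auto
    then show ?thesis using \<open>q \<notin> B\<close> by (simp add: B_def)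
  qed
  ultimately have le: "Suc (card G) \<le> card I + card K" by simp
  have two: "card A \<ge> 2" if "u \<in> A" "v \<in> A" "u \<noteq> v" "finite A" for A :: "'z set" and u v
    using card_mono[of A "{u, v}"] that by simp
  have row: "\<exists>y'. (x, y') \<in> G \<and> y' \<noteq> y" and col: "\<exists>x'. (x', y) \<in> G \<and> x' \<noteq> x" if "(x, y) \<in> G" for x y
    using no_leaf that by blast+
  have "2 * card I \<le> card G"
  proof -
    have "card {e \<in> G. fst e = i} \<ge> 2" if i: "i \<in> I" for i
    proof -
      obtain j where "(i, j) \<in> G" using i by (auto simp: I_def)
      moreover obtain j' where "(i, j') \<in> G" "j' \<noteq> j" using row[OF calculation] by blast
      ultimately show ?thesis by (intro two[of "(i, j)" _ "(i, j')"]) auto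
    qed
    then have "(\<Sum>i\<in>I. 2) \<le> (\<Sum>i\<in>I. card {e \<in> G. fst e = i})" by (intro sum_mono)
    also have "\<dots> = card G"
      using sum.image_gen[of G "\<lambda>_. 1::nat" fst] by (simp add: I_def)
    finally show ?thesis by simp
  qed
  moreover have "2 * card K \<le> card G"
  proof -
    have "card {e \<in> G. snd e = j} \<ge> 2" if j: "j \<in> K" for j
    proof -
      obtain i where "(i, j) \<in> G" using j by (auto simp: K_def)
      moreover obtain i' where "(i', j) \<in> G" "i' \<noteq> i" using col[OF calculation] by blast
      ultimately show ?thesis by (intro two[of "(i, j)" _ "(i', j)"]) auto
    qed
    then have "(\<Sum>j\<in>K. 2) \<le> (\<Sum>j\<in>K. card {e \<in> G. snd e = j})" by (intro sum_mono)
    also have "\<dots> = card G"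
      using sum.image_gen[of G "\<lambda>_. 1::nat" snd] by (simp add: K_def)
    finally show ?thesis by simp
  qed
  ultimately show False using le by simp
qed

section \<open>Families of trees and two-colourings\<close>

text \<open>What the combinatorial part takes from a triangulation. Uniqueness ranges over different
  trees of the family, which reflects that simplices meet in common faces.\<close>

locale tree_family =
  fixes \<G> :: "('a::finite \<times> 'b::finite) set set"
  assumes cover: "sum a UNIV = sum b UNIV \<Longrightarrow> \<exists>F\<in>\<G>. \<exists>l::_ \<Rightarrow> nat. transport F a b l"
    and unique: "F \<in> \<G> \<Longrightarrow> F' \<in> \<G> \<Longrightarrow> transport F a b l \<Longrightarrow> transport F' a b (l'::_ \<Rightarrow> nat) \<Longrightarrow> l = l'"
    and forest: "F \<in> \<G> \<Longrightarrow> bipartite_forest F"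

lemma transport_converse:
  "transport (F\<inverse>) b a (\<lambda>(y, x). l (x, y)) \<longleftrightarrow> transport F a b l"
  unfolding transport_def by (auto simp: split_paired_All)

text \<open>The symmetry that makes the second matching field another instance of the first.\<close>

lemma tree_family_converse:
  assumes "tree_family \<G>"
  shows "tree_family (converse ` \<G>)"
proof
  note cover = tree_family.cover[OF assms] and unique = tree_family.unique[OF assms] and forest = tree_family.forest[OF assms]
  show "\<exists>F\<in>converse ` \<G>. \<exists>l::_ \<Rightarrow> nat. transport F a b l" if eq: "sum a UNIV = sum b UNIV" for a b
  proof -
    obtain F and l :: "_ \<Rightarrow> nat" where "F \<in> \<G>" "transport F b a l"
      using cover[OF eq[symmetric]] by blast
    then show ?thesis by (intro bexI[of _ "F\<inverse>"] exI) (auto intro: iffD2[OF transport_converse])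
  qed
  show "l = l'" if "F \<in> converse ` \<G>" "F' \<in> converse ` \<G>" "transport F a b l" "transport F' a b l'"
    for F F' a b and l l' :: "_ \<Rightarrow> nat"
  proof -
    have "(\<lambda>(y, x). l (x, y)) = (\<lambda>(y, x). l' (x, y))"
      by (rule unique[of "F\<inverse>" "F'\<inverse>"]) (use that in \<open>auto simp: transport_converse\<close>)
    then show ?thesis by (auto simp: fun_eq_iff)
  qed
  show "bipartite_forest F" if "F \<in> converse ` \<G>" for F
    using that forest bipartite_forest_converse by blast
qed

text \<open>Colours the edges of a multigraph of degree at most 2; an edge of multiplicity 2 gets
  both colours. An edge at a leaf is removed, the rest is coloured, and the edge is put back with
  colours that are still free.\<close>

lemma forest_two_colouring:
  fixes k :: "'a::finite \<times> 'b::finite \<Rightarrow> nat"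
  assumes "bipartite_forest F" "\<And>e. e \<notin> F \<Longrightarrow> k e = 0"
    and "\<And>x. (\<Sum>y\<in>UNIV. k (x, y)) \<le> 2" "\<And>y. (\<Sum>x\<in>UNIV. k (x, y)) \<le> 2"
  obtains M N where "M \<subseteq> F" "N \<subseteq> F" "inj_on fst M" "inj_on snd M" "inj_on fst N" "inj_on snd N"
    "\<And>e. k e = of_bool (e \<in> M) + of_bool (e \<in> N)"
proof -
  have "finite F" by simp
  then have "\<exists>M N. M \<subseteq> F \<and> N \<subseteq> F \<and> inj_on fst M \<and> inj_on snd M \<and> inj_on fst N \<and> inj_on snd N \<and>
      (\<forall>e. k e = of_bool (e \<in> M) + of_bool (e \<in> N))"
    using assms
  proof (induction "card F" arbitrary: F k)
    case 0
    then show ?case by auto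
  next
    case (Suc n)
    then have "F \<noteq> {}" by auto
    with Suc.prems(2) obtain x y where xy: "(x, y) \<in> F"
      and leaf: "(\<forall>y'. (x, y') \<in> F \<longrightarrow> y' = y) \<or> (\<forall>x'. (x', y) \<in> F \<longrightarrow> x' = x)"
      using bipartite_forest_leaf by metis
    define e where "e = (x, y)"
    define k' where "k' = k(e := 0)"
    have row: "(\<Sum>z\<in>UNIV. k (u, z)) = (\<Sum>z\<in>UNIV. k' (u, z)) + (if u = x then k e else 0)" for u
    proof -
      have "k (u, z) = k' (u, z) + (if z = y then (if u = x then k e else 0) else 0)" for z
        by (auto simp: k'_def e_def)
      then show ?thesis by (simp add: sum.distrib)
    qed
    have col: "(\<Sum>z\<in>UNIV. k (z, u)) = (\<Sum>z\<in>UNIV. k' (z, u)) + (if u = y then k e else 0)" for u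
    proof -
      have "k (z, u) = k' (z, u) + (if z = x then (if u = y then k e else 0) else 0)" for z
        by (auto simp: k'_def e_def)
      then show ?thesis by (simp add: sum.distrib)
    qed
    have "\<exists>M N. M \<subseteq> F - {e} \<and> N \<subseteq> F - {e} \<and> inj_on fst M \<and> inj_on snd M \<and> inj_on fst N \<and> inj_on snd N \<and>
      (\<forall>e. k' e = of_bool (e \<in> M) + of_bool (e \<in> N))"
    proof (rule Suc.hyps(1)[of "F - {e}"])
      show "n = card (F - {e})" using Suc.hyps(2) xy by (simp add: e_def)
      show "bipartite_forest (F - {e})" using Suc.prems(2) bipartite_forest_mono by blast
      show "k' e' = 0" if "e' \<notin> F - {e}" for e'
        using that Suc.prems(3)[of e'] by (auto simp: k'_def)
      show "(\<Sum>z\<in>UNIV. k' (u, z)) \<le> 2" for u using Suc.prems(4)[of u] unfolding row by simp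
      show "(\<Sum>z\<in>UNIV. k' (z, u)) \<le> 2" for u using Suc.prems(5)[of u] unfolding col by simp
    qed simp
    then obtain M N where MN: "M \<subseteq> F - {e}" "N \<subseteq> F - {e}" "inj_on fst M" "inj_on snd M" "inj_on fst N" "inj_on snd N"
      and k': "\<And>e. k' e = of_bool (e \<in> M) + of_bool (e \<in> N)" by blast
    define free where "free L \<longleftrightarrow> x \<notin> fst ` L \<and> y \<notin> snd ` L" for L :: "('a \<times> 'b) set"
    have ins: "inj_on fst (insert e L)" "inj_on snd (insert e L)" if "free L" "inj_on fst L" "inj_on snd L" for L
      using that by (auto simp: free_def e_def)
    have out: "e \<notin> M" "e \<notin> N" using MN by auto
    have x: "of_bool (x \<in> fst ` L) \<le> (\<Sum>z\<in>UNIV. of_bool ((x, z) \<in> L) :: nat)" for L :: "('a \<times> 'b) set"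
    proof (cases "x \<in> fst ` L")
      case True
      then obtain z where "(x, z) \<in> L" by auto
      then show ?thesis
        using member_le_sum[of z UNIV "\<lambda>z. of_bool ((x, z) \<in> L) :: nat"] by simp
    qed simp
    have y: "of_bool (y \<in> snd ` L) \<le> (\<Sum>z\<in>UNIV. of_bool ((z, y) \<in> L) :: nat)" for L :: "('a \<times> 'b) set"
    proof (cases "y \<in> snd ` L")
      case True
      then obtain z where "(z, y) \<in> L" by auto
      then show ?thesis
        using member_le_sum[of z UNIV "\<lambda>z. of_bool ((z, y) \<in> L) :: nat"] by simp
    qed simp
    \<comment> \<open>Only the end that is not the leaf can block a colour. Its other edges have
      total multiplicity at most \<open>2 - k e\<close>, so at least \<open>k e\<close> colours are
      free.\<close>
    have "of_bool (\<not> free M) + of_bool (\<not> free N) + k e \<le> 2"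
      using leaf
    proof
      assume *: "\<forall>y'. (x, y') \<in> F \<longrightarrow> y' = y"
      have "x \<notin> fst ` L" if "L \<subseteq> F - {e}" for L
        using that * by (fastforce simp: e_def)
      then have "free L \<longleftrightarrow> y \<notin> snd ` L" if "L \<subseteq> F - {e}" for L
        using that by (auto simp: free_def)
      then show ?thesis
        using MN(1,2) y[of M] y[of N] Suc.prems(5)[of y] unfolding col k' sum.distrib by simp
    next
      assume *: "\<forall>x'. (x', y) \<in> F \<longrightarrow> x' = x"
      have "y \<notin> snd ` L" if "L \<subseteq> F - {e}" for L
        using that * by (fastforce simp: e_def)
      then have "free L \<longleftrightarrow> x \<notin> fst ` L" if "L \<subseteq> F - {e}" for L
        using that by (auto simp: free_def)
      then show ?thesis
        using MN(1,2) x[of M] x[of N] Suc.prems(4)[of x] unfolding row k' sum.distrib by simp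
    qed
    then consider "k e = 0" | "k e = 1" "free M" | "k e = 1" "free N" | "k e = 2" "free M" "free N"
      by (cases "free M"; cases "free N") (auto simp: le_Suc_eq numeral_2_eq_2)
    moreover have sub: "M \<subseteq> F" "N \<subseteq> F" "insert e M \<subseteq> F" "insert e N \<subseteq> F"
      using MN xy by (auto simp: e_def)
    ultimately show ?case
    proof cases
      case 1
      then have "k f = of_bool (f \<in> M) + of_bool (f \<in> N)" for f
        using out k'[of f] by (cases "f = e") (auto simp: k'_def)
      then show ?thesis
        using MN sub by (intro exI[of _ M] exI[of _ N]) simp
    next
      case 2
      then have "k f = of_bool (f \<in> insert e M) + of_bool (f \<in> N)" for f
        using out k'[of f] by (cases "f = e") (auto simp: k'_def)
      then show ?thesis
        using MN sub ins[OF 2(2)] by (intro exI[of _ "insert e M"] exI[of _ N]) simp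
    next
      case 3
      then have "k f = of_bool (f \<in> M) + of_bool (f \<in> insert e N)" for f
        using out k'[of f] by (cases "f = e") (auto simp: k'_def)
      then show ?thesis
        using MN sub ins[OF 3(2)] by (intro exI[of _ M] exI[of _ "insert e N"]) simp
    next
      case 4
      then have "k f = of_bool (f \<in> insert e M) + of_bool (f \<in> insert e N)" for f
        using out k'[of f] by (cases "f = e") (auto simp: k'_def)
      then show ?thesis
        using MN sub ins[OF 4(2)] ins[OF 4(3)] by (intro exI[of _ "insert e M"] exI[of _ "insert e N"]) simp
    qed
  qed
  then show thesis using that by blast
qed

section \<open>Pointed matching fields\<close>

text \<open>The bound \<open>w v \<le> c\<close> is forced by the pendant edges: a copy passes all
  its weight to its only row, whose sum is \<open>c\<close>. The case \<open>c = 1\<close> yields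
  matchings, \<open>c = 2\<close> pairs of matchings in one tree.\<close>

locale matching_family =
  fixes \<F> :: "('q::finite \<times> 'v::finite) set set"
  assumes cover: "(\<And>v. w v \<le> c) \<Longrightarrow> sum w UNIV = c * CARD('q) \<Longrightarrow> \<exists>F\<in>\<F>. \<exists>l::_ \<Rightarrow> nat. transport F (\<lambda>_. c) w l"
    and unique: "F \<in> \<F> \<Longrightarrow> F' \<in> \<F> \<Longrightarrow> transport F a b l \<Longrightarrow> transport F' a b (l'::_ \<Rightarrow> nat) \<Longrightarrow> l = l'"
    and forest: "F \<in> \<F> \<Longrightarrow> bipartite_forest F"

text \<open>Common form of both pointed trees: \<open>f\<close> embeds the copies that carry pendant
  edges, \<open>g\<close> the other colour class of the tree.\<close>

definition pointed_extension :: "('q \<Rightarrow> 'v) \<Rightarrow> ('w \<Rightarrow> 'v) \<Rightarrow> ('q \<times> 'w) set \<Rightarrow> ('q \<times> 'v) set" where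
  "pointed_extension f g F = {(q, f q) | q. True} \<union> {(q, g w) | q w. (q, w) \<in> F}"

text \<open>The node \<open>f q\<close> is adjacent to \<open>q\<close> alone, so the weight of its
  edge is prescribed by the marginal. What remains is a weighting of the original tree with row sums
  lowered accordingly, and both existence and uniqueness carry over.\<close>

lemma pointed_extension_matching_family:
  fixes f :: "'a::finite \<Rightarrow> 'v::finite" and g :: "'b::finite \<Rightarrow> 'v"
  assumes \<G>: "tree_family \<G>"
    and inj: "inj f" "inj g" and part: "range f \<inter> range g = {}" "range f \<union> range g = UNIV"
  shows "matching_family (pointed_extension f g ` \<G>)"
proof
  note cover = tree_family.cover[OF \<G>] and unique = tree_family.unique[OF \<G>] and forest = tree_family.forest[OF \<G>]
  have fg: "f q \<noteq> g b" "g b \<noteq> f q" for q b using part(1) by (blast, metis disjoint_iff rangeI part(1))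
  have split: "sum h UNIV = (\<Sum>a\<in>UNIV. h (f a)) + (\<Sum>b\<in>UNIV. h (g b))" for h :: "'v \<Rightarrow> nat"
  proof -
    have "sum h (range f \<union> range g) = sum h (range f) + sum h (range g)"
      by (intro sum.union_disjoint part(1)) auto
    then show ?thesis unfolding part(2) by (simp add: sum.reindex inj o_def)
  qed
  have mem: "(q, f q') \<in> pointed_extension f g F \<longleftrightarrow> q = q'" "(q, g b) \<in> pointed_extension f g F \<longleftrightarrow> (q, b) \<in> F" for q q' b F
    using inj fg by (auto simp: pointed_extension_def inj_def)
  have ball: "(\<forall>v. P v) \<longleftrightarrow> (\<forall>a. P (f a)) \<and> (\<forall>b. P (g b))" for P
    using part(2) by (metis UNIV_I UnE imageE)
  \<comment> \<open>Splits a weighting into its forced part on the pendant edges and a weighting of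
    the original tree.\<close>
  have restrict: "k (q, f q') = (if q = q' then w (f q) else 0)"
    and restrict': "transport F (\<lambda>q. A q - w (f q)) (\<lambda>b. w (g b)) (\<lambda>(q, b). k (q, g b))"
    if k: "transport (pointed_extension f g F) A w k" for F A w q q' and k :: "'a \<times> 'v \<Rightarrow> nat"
  proof -
    have zero: "k (q, f q') = 0" if "q \<noteq> q'" for q q'
      using k that unfolding transport_def by (metis mem(1))
    have "(\<Sum>z\<in>UNIV. k (z, f q)) = (\<Sum>z\<in>UNIV. if z = q then k (q, f q) else 0)" for q
      by (intro sum.cong) (use zero in auto)
    then have diag: "k (q, f q) = w (f q)" for q
      using k unfolding transport_def by simp
    show kf: "k (q, f q') = (if q = q' then w (f q) else 0)" for q q'
      using zero diag by simp
    have "(\<Sum>v\<in>UNIV. k (q, v)) = w (f q) + (\<Sum>b\<in>UNIV. k (q, g b))" for q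
      unfolding split kf by simp
    then have "(\<Sum>b\<in>UNIV. k (q, g b)) = A q - w (f q)" for q
      using k unfolding transport_def by (metis add_diff_cancel_left')
    moreover have "k (q, g b) = 0" if "(q, b) \<notin> F" for q b
      using k that unfolding transport_def by (metis mem(2))
    ultimately show "transport F (\<lambda>q. A q - w (f q)) (\<lambda>b. w (g b)) (\<lambda>(q, b). k (q, g b))"
      using k by (simp add: transport_def)
  qed
  show "bipartite_forest F'" if F': "F' \<in> pointed_extension f g ` \<G>" for F'
    unfolding bipartite_forest_def
  proof (intro allI impI)
    fix G :: "('a \<times> 'v) set" assume G: "G \<subseteq> F'" "G \<noteq> {}"
    obtain F where F: "F \<in> \<G>" "F' = pointed_extension f g F" using F' by blast
    show "\<exists>x y. (x, y) \<in> G \<and> ((\<forall>y'. (x, y') \<in> G \<longrightarrow> y' = y) \<or> (\<forall>x'. (x', y) \<in> G \<longrightarrow> x' = x))"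
    proof (cases "\<exists>q. (q, f q) \<in> G")
      \<comment> \<open>A pendant edge is a leaf edge by itself; otherwise all edges come from the
        original tree and its leaf is used.\<close>
      case True
      then obtain q where q: "(q, f q) \<in> G" by blast
      moreover have "x' = q" if "(x', f q) \<in> G" for x'
        using that G(1) mem(1) unfolding F(2) by blast
      ultimately show ?thesis by blast
    next
      case False
      define H where "H = {(q, b). (q, g b) \<in> G}"
      have Gg: "\<exists>b. v = g b" if "(q, v) \<in> G" for q v
        using that G(1) False unfolding F(2) pointed_extension_def by blast
      have "H \<subseteq> F" using G(1) mem(2) unfolding F(2) H_def by blast
      moreover have "H \<noteq> {}" using G(2) Gg by (fastforce simp: H_def)
      ultimately obtain x b where xb: "(x, b) \<in> H" and
         leaf: "(\<forall>y'. (x, y') \<in> H \<longrightarrow> y' = b) \<or> (\<forall>x'. (x', b) \<in> H \<longrightarrow> x' = x)"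
        using bipartite_forest_leaf[OF bipartite_forest_mono[OF forest[OF F(1)]]] by metis
      have "(\<forall>y'. (x, y') \<in> G \<longrightarrow> y' = g b) \<or> (\<forall>x'. (x', g b) \<in> G \<longrightarrow> x' = x)"
        using leaf
      proof
        assume *: "\<forall>y'. (x, y') \<in> H \<longrightarrow> y' = b"
        have "y' = g b" if "(x, y') \<in> G" for y'
          using Gg[OF that] that * by (auto simp: H_def)
        then show ?thesis by blast
      qed (simp add: H_def)
      with xb show ?thesis by (auto simp: H_def)
    qed
  qed
  show "l = l'" if F: "F \<in> pointed_extension f g ` \<G>" "F' \<in> pointed_extension f g ` \<G>"
    and l: "transport F a b l" "transport F' a b l'" for F F' a b and l l' :: "_ \<Rightarrow> nat"
  proof -
    obtain H H' where H: "H \<in> \<G>" "F = pointed_extension f g H" and H': "H' \<in> \<G>" "F' = pointed_extension f g H'"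
      using F by blast
    have eq: "(\<lambda>(q, b). l (q, g b)) = (\<lambda>(q, b). l' (q, g b))"
      by (rule unique[OF H(1) H'(1) restrict'[OF l(1)[unfolded H(2)]] restrict'[OF l(2)[unfolded H'(2)]]])
    have "\<forall>v. l (q, v) = l' (q, v)" for q
      unfolding ball restrict[OF l(1)[unfolded H(2)]] restrict[OF l(2)[unfolded H'(2)]]
      using fun_cong[OF eq, of "(q, _)"] by simp
    then show ?thesis by (auto simp: fun_eq_iff)
  qed
  show "\<exists>F\<in>pointed_extension f g ` \<G>. \<exists>l::_ \<Rightarrow> nat. transport F (\<lambda>_. c) w l"
    if w: "\<And>v. w v \<le> c" and total: "sum w UNIV = c * CARD('a)" for w c
  proof -
    have "(\<Sum>q\<in>UNIV. c - w (f q)) + (\<Sum>q\<in>UNIV. w (f q)) = c * CARD('a)"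
      using w by (simp add: sum.distrib[symmetric])
    then have "(\<Sum>q\<in>UNIV. c - w (f q)) = (\<Sum>b\<in>UNIV. w (g b))"
      using total unfolding split by simp
    then obtain F and l :: "_ \<Rightarrow> nat" where F: "F \<in> \<G>" and l: "transport F (\<lambda>q. c - w (f q)) (\<lambda>b. w (g b)) l"
      using cover by blast
    \<comment> \<open>Each copy puts its whole weight on its pendant edge, which fills row
      \<open>q\<close> from \<open>c - w (f q)\<close> up to \<open>c\<close>; the subtraction is
      exact because of the bound on \<open>w\<close>.\<close>
    define k where "k = (\<lambda>(q, v). if v \<in> range f then (if v = f q then w v else 0) else l (q, inv g v))"
    have kf: "k (q, f q') = (if q' = q then w (f q) else 0)" and kg: "k (q, g b) = l (q, b)" for q q' b
      using inj part(1) by (auto simp: k_def inj_eq)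
    have "(\<Sum>v\<in>UNIV. k (q, v)) = c" for q
      unfolding split kf kg using l w[of "f q"] by (simp add: transport_def)
    moreover have "\<forall>v. (\<Sum>q\<in>UNIV. k (q, v)) = w v"
      unfolding ball kf kg using l by (simp add: transport_def)
    moreover have "\<forall>v. (q, v) \<notin> pointed_extension f g F \<longrightarrow> k (q, v) = 0" for q
      unfolding ball kf kg mem using l by (simp add: transport_def)
    ultimately have "transport (pointed_extension f g F) (\<lambda>_. c) w k"
      by (simp add: transport_def)
    then show ?thesis using F by blast
  qed
qed

lemma perfect_matching_transport:
  assumes "perfect_matching UNIV \<sigma> M" "M \<subseteq> F"
  shows "transport F (\<lambda>_. 1) (\<lambda>v. of_bool (v \<in> \<sigma>)) (\<lambda>e. of_bool (e \<in> M) :: nat)"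
proof -
  have "(\<Sum>v\<in>UNIV. of_bool ((q, v) \<in> M)) = (1::nat)" for q
  proof -
    have "\<exists>!v. (q, v) \<in> M" using assms(1) unfolding perfect_matching_def by simp
    then obtain v where "(q, v) \<in> M" "\<forall>v'. (q, v') \<in> M \<longrightarrow> v' = v" by (rule ex1E)
    then have "(q, v') \<in> M \<longleftrightarrow> v' = v" for v' by blast
    then show ?thesis by (simp add: of_bool_def)
  qed
  moreover have "(\<Sum>q\<in>UNIV. of_bool ((q, v) \<in> M)) = (of_bool (v \<in> \<sigma>)::nat)" for v
  proof (cases "v \<in> \<sigma>")
    case True
    then have "\<exists>!q. (q, v) \<in> M" using assms(1) unfolding perfect_matching_def by simp
    then obtain q where "(q, v) \<in> M" "\<forall>q'. (q', v) \<in> M \<longrightarrow> q' = q" by (rule ex1E)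
    then have "(q', v) \<in> M \<longleftrightarrow> q' = q" for q' by blast
    then show ?thesis using True by (simp add: of_bool_def)
  next
    case False
    then have "(q, v) \<notin> M" for q
      using assms(1) unfolding perfect_matching_def by blast
    then show ?thesis using False by simp
  qed
  ultimately show ?thesis using assms(2) by (auto simp: transport_def)
qed

lemma perfect_matching_card:
  assumes "perfect_matching (UNIV :: 'q::finite set) (\<sigma> :: 'v::finite set) M"
  shows "card \<sigma> = CARD('q)"
proof -
  have "transport M (\<lambda>_. 1) (\<lambda>v. of_bool (v \<in> \<sigma>)) (\<lambda>e. of_bool (e \<in> M) :: nat)"
    using perfect_matching_transport[OF assms] by blast
  from transport_total[OF this] show ?thesis by simp
qed

context matching_family
begin

text \<open>A natural weighting with all row sums 1 is the indicator of a matching. Conversely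
  matchings are such weightings, so uniqueness of weightings across the family gives uniqueness of
  the matching.\<close>

lemma ex1_perfect_matching:
  assumes "card \<sigma> = CARD('q)"
  shows "\<exists>!M. perfect_matching UNIV \<sigma> M \<and> (\<exists>F\<in>\<F>. M \<subseteq> F)"
proof (rule ex_ex1I)
  have "\<exists>F\<in>\<F>. \<exists>l::_ \<Rightarrow> nat. transport F (\<lambda>_. 1) (\<lambda>v. of_bool (v \<in> \<sigma>)) l"
    by (rule cover) (use assms in simp_all)
  then obtain F and l :: "_ \<Rightarrow> nat" where F: "F \<in> \<F>" and l: "transport F (\<lambda>_. 1) (\<lambda>v. of_bool (v \<in> \<sigma>)) l"
    by blast
  define M where "M = {e. l e \<noteq> 0}"
  have row: "\<exists>!v. (q, v) \<in> M" for q
  proof -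
    have "(\<Sum>v\<in>UNIV. l (q, v)) = 1" using l by (simp add: transport_def)
    then obtain v where "l (q, v) = 1" "\<forall>v'. v \<noteq> v' \<longrightarrow> l (q, v') = 0"
      unfolding sum_eq_1_iff[OF finite] by auto
    then show ?thesis unfolding M_def by (intro ex1I[of _ v]) auto
  qed
  have "\<exists>!q. (q, v) \<in> M" if "v \<in> \<sigma>" for v
  proof -
    have "(\<Sum>q\<in>UNIV. l (q, v)) = 1" using l that by (simp add: transport_def)
    then obtain q where "l (q, v) = 1" "\<forall>q'. q \<noteq> q' \<longrightarrow> l (q', v) = 0"
      unfolding sum_eq_1_iff[OF finite] by auto
    then show ?thesis unfolding M_def by (intro ex1I[of _ q]) auto
  qed
  moreover have "v \<in> \<sigma>" if "(q, v) \<in> M" for q v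
  proof (rule ccontr)
    assume "v \<notin> \<sigma>"
    then have "(\<Sum>q\<in>UNIV. l (q, v)) = 0" using l by (simp add: transport_def)
    then show False using that by (simp add: M_def)
  qed
  ultimately have "perfect_matching UNIV \<sigma> M" using row by (auto simp: perfect_matching_def)
  moreover have "M \<subseteq> F" using l by (auto simp: M_def transport_def simp del: split_paired_All)
  ultimately show "\<exists>M. perfect_matching UNIV \<sigma> M \<and> (\<exists>F\<in>\<F>. M \<subseteq> F)" using F by blast
next
  fix M M'
  assume "perfect_matching UNIV \<sigma> M \<and> (\<exists>F\<in>\<F>. M \<subseteq> F)" "perfect_matching UNIV \<sigma> M' \<and> (\<exists>F\<in>\<F>. M' \<subseteq> F)"
  then have "(\<lambda>e. of_bool (e \<in> M) :: nat) = (\<lambda>e. of_bool (e \<in> M'))"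
    using unique perfect_matching_transport by metis
  then have "of_bool (e \<in> M) = (of_bool (e \<in> M') :: nat)" for e by (rule fun_cong)
  then show "M = M'" by (intro set_eqI) (simp only: of_bool_eq_iff)
qed

lemma matching_field:
  assumes "card \<sigma> = CARD('q)"
  shows "perfect_matching UNIV \<sigma> (matching_field \<F> \<sigma>)" "\<exists>F\<in>\<F>. matching_field \<F> \<sigma> \<subseteq> F"
  using theI'[OF ex1_perfect_matching[OF assms]] unfolding matching_field_def by blast+

lemma matching_field_eqI:
  assumes "perfect_matching UNIV \<sigma> M" "F \<in> \<F>" "M \<subseteq> F"
  shows "matching_field \<F> \<sigma> = M"
  unfolding matching_field_def
  by (rule the1_equality[OF ex1_perfect_matching]) (use assms perfect_matching_card in auto)

text \<open>The degrees total \<open>2 * card S + 4\<close>, twice the number of rows. In the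
  2-colouring, degree 2 means meeting both colours: so both classes cover all rows and all of
  \<open>S\<close>, while each element of \<open>U\<close> meets exactly one. Which pairs of
  \<open>U\<close> go together is not controlled.\<close>

lemma compatible_matchings:
  assumes S: "card S + 2 = CARD('q)" and U: "card U = 4" "S \<inter> U = {}"
  obtains F \<sigma> \<tau> where "F \<in> \<F>" "\<sigma> \<union> \<tau> = S \<union> U" "\<sigma> \<inter> \<tau> = S" "card \<sigma> = CARD('q)" "card \<tau> = CARD('q)"
    "matching_field \<F> \<sigma> \<subseteq> F" "matching_field \<F> \<tau> \<subseteq> F"
proof -
  define w :: "'v \<Rightarrow> nat" where "w v = of_bool (v \<in> S \<union> U) + of_bool (v \<in> S)" for v
  have "card (S \<union> U) = card S + 4" using U by (simp add: card_Un_disjoint)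
  then have "sum w UNIV = 2 * CARD('q)"
    using S unfolding w_def sum.distrib sum_of_bool_eq[OF finite finite] by (simp del: Un_iff)
  moreover have "w v \<le> 2" for v by (simp add: w_def)
  ultimately obtain F and k :: "_ \<Rightarrow> nat" where F: "F \<in> \<F>" and k: "transport F (\<lambda>_. 2) w k"
    using cover[of w 2] by blast
  have kr: "(\<Sum>v\<in>UNIV. k (q, v)) = 2" and kc: "(\<Sum>q\<in>UNIV. k (q, v)) = w v" and k0: "e \<notin> F \<Longrightarrow> k e = 0" for q v e
    using k unfolding transport_def by (simp_all del: split_paired_All)
  obtain M N where MN: "M \<subseteq> F" "N \<subseteq> F" "inj_on fst M" "inj_on snd M" "inj_on fst N" "inj_on snd N"
    and kMN: "\<And>e. k e = of_bool (e \<in> M) + of_bool (e \<in> N)"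
    by (rule forest_two_colouring[OF forest[OF F] k0]) (auto simp: kr kc w_def)
  have fst_eq: "v' = v" if "inj_on fst L" "(q, v) \<in> L" "(q, v') \<in> L" for q v v' and L :: "('q \<times> 'v) set"
    using inj_onD[OF that(1) _ that(3,2)] by simp
  have snd_eq: "q' = q" if "inj_on snd L" "(q, v) \<in> L" "(q', v) \<in> L" for q q' v and L :: "('q \<times> 'v) set"
    using inj_onD[OF that(1) _ that(3,2)] by simp
  have row: "(\<Sum>v\<in>UNIV. of_bool ((q, v) \<in> L)) = (of_bool (q \<in> fst ` L) :: nat)" if L: "inj_on fst L" for q and L :: "('q \<times> 'v) set"
  proof (cases "q \<in> fst ` L")
    case True
    then obtain v where "(q, v) \<in> L" by auto
    then have "(q, v') \<in> L \<longleftrightarrow> v' = v" for v'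
      using fst_eq[OF L] by blast
    then show ?thesis using True by (simp add: of_bool_def)
  next
    case False
    then have "(q, v) \<notin> L" for v by force
    then show ?thesis using False by simp
  qed
  have col: "(\<Sum>q\<in>UNIV. of_bool ((q, v) \<in> L)) = (of_bool (v \<in> snd ` L) :: nat)" if L: "inj_on snd L" for v and L :: "('q \<times> 'v) set"
  proof (cases "v \<in> snd ` L")
    case True
    then obtain q where "(q, v) \<in> L" by auto
    then have "(q', v) \<in> L \<longleftrightarrow> q' = q" for q'
      using snd_eq[OF L] by blast
    then show ?thesis using True by (simp add: of_bool_def)
  next
    case False
    then have "(q, v) \<notin> L" for q by force
    then show ?thesis using False by simp
  qed
  have two: "of_bool (q \<in> fst ` M) + of_bool (q \<in> fst ` N) = (2::nat)" for q
    using kr[of q] unfolding kMN sum.distrib row[OF MN(3)] row[OF MN(5)] .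
  have "q \<in> fst ` M \<and> q \<in> fst ` N" for q
    using two[of q] by (auto simp: of_bool_def split: if_splits)
  then have fst: "q \<in> fst ` M" "q \<in> fst ` N" for q by blast+
  have snd_two: "of_bool (v \<in> snd ` M) + of_bool (v \<in> snd ` N) = w v" for v
    using kc[of v] unfolding kMN sum.distrib col[OF MN(4)] col[OF MN(6)] .
  have "(v \<in> snd ` M \<or> v \<in> snd ` N \<longleftrightarrow> v \<in> S \<union> U) \<and> (v \<in> snd ` M \<and> v \<in> snd ` N \<longleftrightarrow> v \<in> S)" for v
    using snd_two[of v] unfolding w_def by (auto simp: of_bool_def split: if_splits)
  then have snd: "snd ` M \<union> snd ` N = S \<union> U" "snd ` M \<inter> snd ` N = S" by blast+
  have pm: "perfect_matching UNIV (snd ` L) L" if L: "inj_on fst L" "inj_on snd L" "\<And>q. q \<in> fst ` L" for L :: "('q \<times> 'v) set"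
  proof -
    have "\<exists>!v. (q, v) \<in> L" for q
    proof -
      obtain v where qv: "(q, v) \<in> L" using L(3)[of q] by auto
      show ?thesis by (rule ex1I, rule qv, erule fst_eq[OF L(1) qv])
    qed
    moreover have "\<exists>!q. (q, v) \<in> L" if v: "v \<in> snd ` L" for v
    proof -
      obtain q where qv: "(q, v) \<in> L" using v by auto
      show ?thesis by (rule ex1I, rule qv, erule snd_eq[OF L(2) qv])
    qed
    moreover have "L \<subseteq> UNIV \<times> snd ` L" by force
    ultimately show ?thesis by (simp add: perfect_matching_def)
  qed
  note pmM = pm[OF MN(3,4) fst(1)] and pmN = pm[OF MN(5,6) fst(2)]
  show thesis
    using that[OF F snd perfect_matching_card[OF pmM] perfect_matching_card[OF pmN]]
      matching_field_eqI[OF pmM F MN(1)] matching_field_eqI[OF pmN F MN(2)] MN(1,2) by simp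
qed

end

section \<open>Grassmann--Pluecker relations from three-term relations\<close>

definition order_sgn :: "'v::linorder \<Rightarrow> 'v \<Rightarrow> int" where
  "order_sgn x y = (if x < y then 1 else -1)"

text \<open>For \<open>v\<close> outside a finite \<open>W\<close>, the sign of the list that
  enumerates \<open>W\<close> increasingly and ends in \<open>v\<close>.\<close>

definition cross_sgn :: "'v::linorder set \<Rightarrow> 'v \<Rightarrow> int" where
  "cross_sgn W v = (\<Prod>w\<in>W. order_sgn w v)"

lemma order_sgn_swap: "x \<noteq> y \<Longrightarrow> order_sgn y x = - order_sgn x y"
  by (auto simp: order_sgn_def)

lemma order_sgn_sign: "order_sgn x y \<in> {-1, 1}"
  by (simp add: order_sgn_def)

lemma sign_prod: "(\<And>i. i \<in> I \<Longrightarrow> f i \<in> {-1, 1::int}) \<Longrightarrow> prod f I \<in> {-1, 1}"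
proof (induction I rule: infinite_finite_induct)
  case (insert x F)
  then have "f x \<in> {-1, 1}" "prod f F \<in> {-1, 1}" by blast+
  then have "f x * prod f F \<in> {-1, 1}" by fastforce
  then show ?case using insert(1,2) by simp
qed auto

lemma cross_sgn_sign: "cross_sgn W v \<in> {-1, 1}"
  unfolding cross_sgn_def by (rule sign_prod) (rule order_sgn_sign)

lemma cross_sgn_insert:
  "finite W \<Longrightarrow> w \<notin> W \<Longrightarrow> cross_sgn (insert w W) v = order_sgn w v * cross_sgn W v"
  by (simp add: cross_sgn_def)

lemma sign_square: "a \<in> {-1, 1::int} \<Longrightarrow> a * a = 1" by auto

text \<open>For values in \<open>{-1, 1}\<close>, the relation says that
  \<open>p a b * p c d\<close>, \<open>- (p a c * p b d)\<close> and \<open>p a d * p b c\<close>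
  are not all equal. The signs of moving \<open>a, b, c, d\<close> past \<open>S\<close> are
  omitted: each would occur once in every product.\<close>

definition three_term :: "nat \<Rightarrow> ('v::linorder set \<Rightarrow> int) \<Rightarrow> bool" where
  "three_term r G \<longleftrightarrow>
     (\<forall>S a b c d. finite S \<longrightarrow> card S + 2 = r \<longrightarrow> distinct [a, b, c, d] \<longrightarrow> S \<inter> {a, b, c, d} = {} \<longrightarrow>
       (let p = (\<lambda>x y. G (insert x (insert y S)) * order_sgn x y)
        in \<not> (p a b * p c d = - (p a c * p b d) \<and> p a b * p c d = p a d * p b c)))"

text \<open>For \<open>y\<close> in \<open>Y - X\<close>, the term at \<open>y\<close> of the
  general relation, up to a sign independent of \<open>y\<close>; the cross signs stand for the
  positions of \<open>y\<close> in ordered tuples.\<close>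

definition gp_term :: "('v::linorder set \<Rightarrow> int) \<Rightarrow> 'v set \<Rightarrow> 'v set \<Rightarrow> 'v \<Rightarrow> int" where
  "gp_term G X Y y = G (insert y X) * cross_sgn X y * (G (Y - {y}) * cross_sgn (Y - {y}) y)"

text \<open>A circuit \<open>Y\<close> all of whose terms have the same sign is replaced by the circuit in \<open>insert x Y\<close>
  that avoids the greatest element of \<open>Y - X\<close> in the order of the rank 2 dual; this keeps the signs
  equal and makes \<open>X - Y\<close> smaller.\<close>
lemma gp_from_three_term:
  fixes G :: "'v::linorder set \<Rightarrow> int"
  assumes G: "\<And>W. finite W \<Longrightarrow> card W = r \<Longrightarrow> G W \<in> {-1, 1}" and three: "three_term r G"
    and X: "finite X" "Suc (card X) = r" and Y: "finite Y" "card Y = Suc r"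
  shows "\<exists>y\<in>Y - X. \<exists>z\<in>Y - X. gp_term G X Y y \<noteq> gp_term G X Y z"
  using Y
proof (induction "card (X - Y)" arbitrary: Y)
  case 0
  then have sub: "X \<subseteq> Y" using X(1) by simp
  \<comment> \<open>Once \<open>X\<close> lies inside \<open>Y\<close> there are two terms, equal up
    to \<open>order_sgn y z\<close>, which changes sign when \<open>y\<close> and \<open>z\<close>
    are interchanged.\<close>
  then have "card (Y - X) = 2" using X 0 by (simp add: card_Diff_subset)
  then obtain y z where yz: "Y - X = {y, z}" "y \<noteq> z" by (auto simp: card_2_iff)
  then have Yd: "Y - {y} = insert z X" "Y - {z} = insert y X" "y \<notin> X" "z \<notin> X" using sub by auto
  have "gp_term G X Y y = (G (insert y X) * G (insert z X)) * (cross_sgn X y * cross_sgn X y) * order_sgn z y"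
    unfolding gp_term_def Yd using X(1) Yd by (simp add: cross_sgn_insert)
  moreover have "gp_term G X Y z = (G (insert y X) * G (insert z X)) * (cross_sgn X z * cross_sgn X z) * order_sgn y z"
    unfolding gp_term_def Yd using X(1) Yd by (simp add: cross_sgn_insert)
  moreover have "G (insert y X) \<in> {-1, 1}" "G (insert z X) \<in> {-1, 1}"
    using G X Yd by simp_all
  ultimately have "gp_term G X Y y \<noteq> gp_term G X Y z"
    using order_sgn_sign[of y z] unfolding order_sgn_swap[OF yz(2)] sign_square[OF cross_sgn_sign] by auto
  then show ?case using yz by blast
next
  case (Suc n)
  show ?case
  proof (rule ccontr)
    assume "\<not> ?case"
    then have const: "gp_term G X Y y = gp_term G X Y z" if "y \<in> Y - X" "z \<in> Y - X" for y z
      using that by blast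
    from Suc(2) obtain x where x: "x \<in> X" "x \<notin> Y" by (metis Diff_iff card.empty ex_in_conv nat.distinct(1))
    define Z where "Z = insert x Y"
    have Z: "finite Z" "card Z = Suc (Suc r)" using x Suc.prems by (simp_all add: Z_def)
    text \<open>The rank 2 oriented matroid dual to the restriction to \<open>Z\<close>.\<close>
    define \<psi> where "\<psi> u v = G (Z - {u, v}) * cross_sgn (Z - {u}) u * cross_sgn (Z - {v}) v * order_sgn u v" for u v
    have card2: "card (Z - {u, v}) = r" if "u \<in> Z" "v \<in> Z" "u \<noteq> v" for u v
      using that Z by (simp add: card_Diff_subset)
    have sign: "\<psi> u v \<in> {-1, 1}" if "u \<in> Z" "v \<in> Z" "u \<noteq> v" for u v
      using G[OF _ card2[OF that]] Z(1) cross_sgn_sign[of "Z - {u}" u] cross_sgn_sign[of "Z - {v}" v] order_sgn_sign[of u v]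
      by (auto simp: \<psi>_def)
    have anti: "\<psi> v u = - \<psi> u v" if "u \<noteq> v" for u v
      by (simp add: \<psi>_def order_sgn_swap[OF that] insert_commute)
    have pluecker: "\<not> (\<psi> a b * \<psi> c d = - (\<psi> a c * \<psi> b d) \<and> \<psi> a b * \<psi> c d = \<psi> a d * \<psi> b c)"
      if abcd: "distinct [a, b, c, d]" "{a, b, c, d} \<subseteq> Z" for a b c d
    proof -
      define S where "S = Z - {a, b, c, d}"
      have S: "finite S" "S \<inter> {a, b, c, d} = {}" using Z by (auto simp: S_def)
      have "card {a, b, c, d} = 4" using abcd(1) by simp
      then have cS: "card S + 2 = r" using Z card_mono[OF Z(1) abcd(2)] abcd(2) by (simp add: S_def card_Diff_subset)
      have comp: "Z - {a, b} = insert c (insert d S)" "Z - {c, d} = insert a (insert b S)"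
        "Z - {a, c} = insert b (insert d S)" "Z - {b, d} = insert a (insert c S)"
        "Z - {a, d} = insert b (insert c S)" "Z - {b, c} = insert a (insert d S)"
        using abcd by (auto simp: S_def)
      \<comment> \<open>Complementation interchanges the two values of \<open>G\<close> in each
        product, and each of the four cross signs occurs once per product, so all three products
        scale by the same \<open>C\<close>.\<close>
      define C where "C = cross_sgn (Z - {a}) a * cross_sgn (Z - {b}) b * cross_sgn (Z - {c}) c * cross_sgn (Z - {d}) d"
      have C0: "C \<noteq> 0"
        using cross_sgn_sign[of "Z - {a}" a] cross_sgn_sign[of "Z - {b}" b]
          cross_sgn_sign[of "Z - {c}" c] cross_sgn_sign[of "Z - {d}" d] by (auto simp: C_def)
      define p where "p = (\<lambda>x y. G (insert x (insert y S)) * order_sgn x y)"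
      have "\<psi> a b * \<psi> c d = C * (p a b * p c d)" "\<psi> a c * \<psi> b d = C * (p a c * p b d)"
        "\<psi> a d * \<psi> b c = C * (p a d * p b c)"
        by (simp_all add: \<psi>_def p_def C_def comp mult_ac)
      moreover have "\<not> (p a b * p c d = - (p a c * p b d) \<and> p a b * p c d = p a d * p b c)"
        using three[unfolded three_term_def, rule_format, OF S(1) cS abcd(1) S(2)]
        unfolding Let_def p_def .
      ultimately show ?thesis using C0
        by (metis mult_cancel_left mult_minus_right)
    qed
    define W where "W = Y - X"
    have W: "finite W" "W \<subseteq> Z" "x \<notin> W" "x \<in> Z" using Suc.prems x by (auto simp: W_def Z_def)
    have "X \<inter> Y \<subseteq> X - {x}" using x by auto
    then have "card (X \<inter> Y) < card X"
      using X(1) x by (intro psubset_card_mono) auto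
    moreover have "card Y = card (X \<inter> Y) + card W"
      using Suc.prems card_mono[of Y "X \<inter> Y"] by (simp add: W_def card_Diff_subset_Int Int_commute)
    ultimately have "card W \<ge> 1" using X Suc.prems by simp
    then have W0: "W \<noteq> {}" by auto
    \<comment> \<open>For vectors in the plane: after negating some of them so that all lie on one
      side of \<open>x\<close>, \<open>\<psi>\<close> compares angles, and \<open>R\<close> is this
      comparison.\<close>
    define R where "R u v \<longleftrightarrow> u \<noteq> v \<and> \<psi> u v * \<psi> u x * \<psi> v x = 1" for u v
    have R_anti: "\<not> R v u" if "R u v" for u v
      using that anti[of u v] by (auto simp: R_def mult_ac)
    then have "asymp_on W R"
      by (intro asymp_onI)
    moreover have "transp_on W R"
    proof (rule transp_onI)
      fix u v w assume uvw: "u \<in> W" "v \<in> W" "w \<in> W" and R: "R u v" "R v w"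
      then have ne: "u \<noteq> v" "v \<noteq> w" "u \<noteq> w" using R_anti by (auto simp: R_def)
      have xne: "u \<noteq> x" "v \<noteq> x" "w \<noteq> x" using uvw W by auto
      have mem: "u \<in> Z" "v \<in> Z" "w \<in> Z" using uvw W by auto
      \<comment> \<open>Failure of transitivity would be a cyclic triple, which is exactly what the
        three-term relation on \<open>u, v, w, x\<close> excludes.\<close>
      have "\<not> (\<psi> u v * \<psi> w x = - (\<psi> u w * \<psi> v x) \<and> \<psi> u v * \<psi> w x = \<psi> u x * \<psi> v w)"
        by (rule pluecker) (use ne xne mem W in auto)
      moreover have "\<psi> u v * \<psi> u x * \<psi> v x = 1" "\<psi> v w * \<psi> v x * \<psi> w x = 1"
        using R by (simp_all add: R_def)
      moreover have "\<psi> u v \<in> {-1, 1}" "\<psi> u w \<in> {-1, 1}" "\<psi> v w \<in> {-1, 1}"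
        "\<psi> u x \<in> {-1, 1}" "\<psi> v x \<in> {-1, 1}" "\<psi> w x \<in> {-1, 1}"
        using ne xne mem W by (intro sign; simp)+
      ultimately have "\<psi> u w * \<psi> u x * \<psi> w x = 1" by auto
      then show "R u w" using ne by (simp add: R_def)
    qed
    ultimately obtain m where m: "m \<in> W" "\<And>u. u \<in> W \<Longrightarrow> u \<noteq> m \<Longrightarrow> \<not> R m u"
      using Finite_Set.bex_max_element[OF W(1) _ _ W0, of R] by blast
    have mx: "m \<in> Z" "m \<noteq> x" "m \<notin> X" "m \<in> Y" using m(1) W by (auto simp: W_def)
    \<comment> \<open>Extremality of \<open>m\<close> ties all signs \<open>\<psi> u m\<close> to
      \<open>\<psi> u x\<close> by the single constant \<open>\<psi> m x\<close>.\<close>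
    have proportional: "\<psi> u m = \<psi> m x * \<psi> u x" if "u \<in> W" "u \<noteq> m" for u
    proof -
      have "\<psi> m u * \<psi> m x * \<psi> u x \<noteq> 1" using m(2)[OF that] that by (auto simp: R_def)
      moreover have "\<psi> m u \<in> {-1, 1}" "\<psi> m x \<in> {-1, 1}" "\<psi> u x \<in> {-1, 1}"
        using that mx W by (intro sign; auto)+
      ultimately show ?thesis using anti[of m u] that by auto
    qed
    \<comment> \<open>The signs of the circuit in \<open>Z - {t}\<close> are, up to one global sign,
      the values \<open>\<psi> u t\<close> of the dual.\<close>
    have circuit: "G (Z - {t} - {u}) * cross_sgn (Z - {t} - {u}) u = - \<psi> u t * cross_sgn (Z - {t}) t"
      if "t \<in> Z" "u \<in> Z" "u \<noteq> t" for t u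
    proof -
      have "Z - {u} = insert t (Z - {t} - {u})" using that by auto
      then have "cross_sgn (Z - {u}) u = order_sgn t u * cross_sgn (Z - {t} - {u}) u"
        using Z(1) by (metis Diff_iff cross_sgn_insert finite_Diff insertI1)
      moreover have "Z - {u, t} = Z - {t} - {u}" by auto
      ultimately have "\<psi> u t = G (Z - {t} - {u}) * cross_sgn (Z - {t} - {u}) u * cross_sgn (Z - {t}) t * (order_sgn t u * order_sgn u t)"
        by (simp add: \<psi>_def)
      moreover have "order_sgn t u * order_sgn u t = -1"
        using that by (auto simp: order_sgn_def)
      ultimately show ?thesis
        using cross_sgn_sign[of "Z - {t}" t] by auto
    qed
    define Y' where "Y' = Z - {m}"
    have "X - Y' = X - Y - {x}" using mx x by (auto simp: Y'_def Z_def)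
    then have "n = card (X - Y')" using Suc(2) x X by simp
    moreover have "finite Y'" "card Y' = Suc r" using Z mx by (simp_all add: Y'_def)
    moreover have Y'X: "Y' - X = W - {m}" using x by (auto simp: Y'_def Z_def W_def)
    ultimately obtain y z where yz: "y \<in> W - {m}" "z \<in> W - {m}" "gp_term G X Y' y \<noteq> gp_term G X Y' z"
      using Suc.hyps(1)[of Y'] by auto
    have Yx: "Y = Z - {x}" using x by (auto simp: Z_def)
    \<comment> \<open>The circuits avoiding \<open>m\<close> and \<open>x\<close> are therefore
      proportional on \<open>W - {m}\<close>: equal terms for \<open>Y\<close> would give equal
      terms for \<open>Y'\<close>, against the induction hypothesis.\<close>
    have "gp_term G X Y' u = \<psi> m x * cross_sgn (Z - {m}) m * cross_sgn (Z - {x}) x * gp_term G X Y u"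
      if u: "u \<in> W - {m}" for u
    proof -
      have uZ: "u \<in> Z" "u \<noteq> x" "u \<noteq> m" using u W by auto
      have "gp_term G X Y' u = G (insert u X) * cross_sgn X u * (- (\<psi> m x * \<psi> u x) * cross_sgn (Z - {m}) m)"
        unfolding gp_term_def Y'_def circuit[OF mx(1) uZ(1,3)] using proportional[of u] u by simp
      moreover have "gp_term G X Y u = G (insert u X) * cross_sgn X u * (- \<psi> u x * cross_sgn (Z - {x}) x)"
        unfolding gp_term_def Yx circuit[OF W(4) uZ(1,2)] ..
      ultimately show ?thesis
        using cross_sgn_sign[of "Z - {x}" x] by auto
    qed
    with yz const[of y z] show False by (auto simp: W_def)
  qed
qed

section \<open>Signs of orderings\<close>

lemma distinct_permutation_exists:
  assumes "distinct xs" "distinct ys" "set xs = set ys"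
  obtains \<pi> where "\<pi> permutes {..<length ys}" "permute_list \<pi> ys = xs"
proof -
  have "mset xs = mset ys" using assms by (simp add: set_eq_iff_mset_eq_distinct)
  then show thesis using mset_eq_permutation that by metis
qed

lemma ordering_sign_eq:
  assumes "distinct xs" "\<pi> permutes {..<length xs}" "permute_list \<pi> (sorted_list_of_set (set xs)) = xs"
  shows "ordering_sign xs = sign \<pi>"
proof -
  define ss where "ss = sorted_list_of_set (set xs)"
  have len: "length ss = length xs" using assms(1) by (simp add: ss_def distinct_card)
  have nth: "xs ! i = ss ! \<pi> i" if "i < length xs" for i
    using permute_list_nth[of \<pi> ss i] assms(2,3) that len by (simp add: ss_def)
  have "(THE \<pi>. \<pi> permutes {..<length xs} \<and> (\<forall>i<length xs. xs ! i = ss ! \<pi> i)) = \<pi>"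
  proof (rule the_equality)
    fix \<rho> assume \<rho>: "\<rho> permutes {..<length xs} \<and> (\<forall>i<length xs. xs ! i = ss ! \<rho> i)"
    show "\<rho> = \<pi>"
    proof
      fix i
      show "\<rho> i = \<pi> i"
      proof (cases "i < length xs")
        case True
        then have "\<rho> i < length ss" "\<pi> i < length ss"
          using \<rho> assms(2) permutes_in_image[of _ "{..<length xs}" i] len by auto
        moreover have "ss ! \<rho> i = ss ! \<pi> i" using \<rho> nth True by metis
        ultimately show ?thesis by (simp add: ss_def nth_eq_iff_index_eq)
      next
        case False
        then show ?thesis using \<rho> assms(2) by (metis lessThan_iff permutes_not_in)
      qed
    qed
  qed (use assms(2) nth in simp)
  then show ?thesis unfolding ordering_sign_def ss_def by simp
qed

lemma ordering_sign_permute: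
  assumes "distinct xs" "\<pi> permutes {..<length xs}"
  shows "ordering_sign (permute_list \<pi> xs) = sign \<pi> * ordering_sign xs"
proof -
  define ss where "ss = sorted_list_of_set (set xs)"
  have len: "length ss = length xs" using assms(1) by (simp add: ss_def distinct_card)
  obtain \<rho> where \<rho>: "\<rho> permutes {..<length xs}" "permute_list \<rho> ss = xs"
    using distinct_permutation_exists[of xs ss, OF assms(1)] len by (metis List.finite_set distinct_sorted_list_of_set set_sorted_list_of_set ss_def)
  have "ordering_sign xs = sign \<rho>"
    using ordering_sign_eq[OF assms(1) \<rho>(1)] \<rho>(2) by (simp add: ss_def)
  moreover have "ordering_sign (permute_list \<pi> xs) = sign (\<rho> \<circ> \<pi>)"
  proof (rule ordering_sign_eq)
    have "permute_list (\<rho> \<circ> \<pi>) ss = permute_list \<pi> xs"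
      using permute_list_compose[of \<pi> ss \<rho>] assms(2) \<rho> len by simp
    then show "permute_list (\<rho> \<circ> \<pi>) (sorted_list_of_set (set (permute_list \<pi> xs))) = permute_list \<pi> xs"
      using assms by (simp add: ss_def)
  qed (use assms \<rho>(1) in \<open>simp_all add: permutes_compose\<close>)
  moreover have "sign (\<rho> \<circ> \<pi>) = sign \<rho> * sign \<pi>"
    using assms(2) \<rho>(1) by (intro sign_compose) (auto intro: permutation_permutes[THEN iffD2] finite_lessThan)
  ultimately show ?thesis by simp
qed

lemma sign_mem: "sign p \<in> {-1, 1}"
  by (simp add: sign_def)

lemma ordering_sign_mem: "distinct xs \<Longrightarrow> ordering_sign xs \<in> {-1, 1}"
  using ordering_sign_eq distinct_permutation_exists[of xs "sorted_list_of_set (set xs)"] sign_mem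
  by (metis List.finite_set distinct_card distinct_sorted_list_of_set length_sorted_list_of_set set_sorted_list_of_set)

text \<open>The parity of inversions, by recursion on the list. It replaces
  \<open>ordering_sign\<close> wherever entries are deleted or lists are appended.\<close>

fun inversion_sign :: "'v::linorder list \<Rightarrow> int" where
  "inversion_sign [] = 1"
| "inversion_sign (x # xs) = (\<Prod>y\<in>set xs. order_sgn x y) * inversion_sign xs"

text \<open>Moving \<open>v\<close> to the end passes \<open>length vs\<close> entries; there it
  forms one pair with each remaining entry \<open>w\<close>, contributing
  \<open>order_sgn w v\<close>.\<close>

lemma inversion_sign_delete:
  assumes "distinct (us @ v # vs)"
  shows "inversion_sign (us @ v # vs) =
    (-1) ^ length vs * cross_sgn (set us \<union> set vs) v * inversion_sign (us @ vs)"
  using assms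
proof (induction us)
  case Nil
  have "(\<Prod>y\<in>set vs. order_sgn v y) = (\<Prod>y\<in>set vs. - order_sgn y v)"
    by (intro prod.cong) (use Nil in \<open>auto intro: order_sgn_swap\<close>)
  also have "\<dots> = (-1) ^ length vs * cross_sgn (set vs) v"
    using Nil by (simp add: prod_uminus cross_sgn_def distinct_card)
  finally show ?case by simp
next
  case (Cons u us)
  then have "cross_sgn (insert u (set us \<union> set vs)) v = order_sgn u v * cross_sgn (set us \<union> set vs) v"
    by (intro cross_sgn_insert) auto
  moreover have "(\<Prod>y\<in>set (us @ v # vs). order_sgn u y) = order_sgn u v * (\<Prod>y\<in>set (us @ vs). order_sgn u y)"
    using Cons by simp
  ultimately show ?case using Cons by (simp del: set_append)
qed

lemma inversion_sign_swap:
  assumes "distinct (us @ a # b # vs)"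
  shows "inversion_sign (us @ b # a # vs) = - inversion_sign (us @ a # b # vs)"
  using assms
proof (induction us)
  case Nil
  then show ?case using order_sgn_swap[of a b] by simp
next
  case (Cons u us)
  then show ?case by (simp add: insert_commute)
qed

lemma ordering_sign_swap:
  assumes "distinct (us @ a # b # vs)"
  shows "ordering_sign (us @ b # a # vs) = - ordering_sign (us @ a # b # vs)"
proof -
  define xs where "xs = us @ a # b # vs"
  let ?k = "length us"
  have \<pi>: "Transposition.transpose ?k (Suc ?k) permutes {..<length xs}"
    by (intro permutes_swap_id) (auto simp: xs_def)
  have "permute_list (Transposition.transpose ?k (Suc ?k)) xs = us @ b # a # vs"
  proof (rule nth_equalityI)
    fix i assume i: "i < length (permute_list (Transposition.transpose ?k (Suc ?k)) xs)"
    then have "permute_list (Transposition.transpose ?k (Suc ?k)) xs ! i = xs ! Transposition.transpose ?k (Suc ?k) i"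
      using permute_list_nth[OF \<pi>] by simp
    also have "\<dots> = (us @ b # a # vs) ! i"
      by (auto simp: xs_def nth_append Transposition.transpose_def nth_Cons' split: if_splits)
    finally show "permute_list (Transposition.transpose ?k (Suc ?k)) xs ! i = (us @ b # a # vs) ! i" .
  qed (simp add: xs_def)
  then show ?thesis
    using ordering_sign_permute[OF assms[folded xs_def] \<pi>] by (simp add: sign_swap_id xs_def)
qed

text \<open>Adjacent swaps connect any two orderings of a set. The prefix \<open>us\<close> in the
  inner claims lets the induction fix one entry after the other.\<close>

lemma adjacent_swap_invariant:
  assumes swap: "\<And>us a b vs. distinct (us @ a # b # vs) \<Longrightarrow> h (us @ b # a # vs) = h (us @ a # b # vs)"
    and "distinct xs" "mset xs = mset ys"
  shows "h xs = h ys"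
proof -
  have move: "h (us @ vs @ x # ws) = h (us @ x # vs @ ws)" if "distinct (us @ vs @ x # ws)" for us vs ws x
    using that
  proof (induction vs arbitrary: us)
    case (Cons v vs)
    have "h (us @ (v # vs) @ x # ws) = h ((us @ [v]) @ x # vs @ ws)"
      using Cons.IH[of "us @ [v]"] Cons.prems by simp
    also have "\<dots> = h (us @ x # v # vs @ ws)"
      using swap[of us x v "vs @ ws"] Cons.prems by auto
    finally show ?case by simp
  qed simp
  have "h (us @ xs) = h (us @ ys)" if "distinct (us @ xs)" "mset xs = mset ys" for us
    using that
  proof (induction xs arbitrary: us ys)
    case (Cons x xs)
    then have "x \<in> set ys" by (metis list.set_intros(1) mset_eq_setD)
    then obtain zs ws where ys: "ys = zs @ x # ws" by (meson split_list)
    have mset: "mset xs = mset (zs @ ws)" using Cons.prems(2) by (simp add: ys)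
    have "distinct (us @ zs @ x # ws)"
      using Cons.prems unfolding ys[symmetric]
      by (metis distinct_append mset_eq_imp_distinct_iff mset_eq_setD)
    have "h (us @ x # xs) = h ((us @ [x]) @ xs)" by simp
    also have "\<dots> = h ((us @ [x]) @ zs @ ws)"
      by (rule Cons.IH) (use Cons.prems mset in simp_all)
    also have "\<dots> = h (us @ ys)" using move[OF \<open>distinct (us @ zs @ x # ws)\<close>] by (simp add: ys)
    finally show ?case .
  qed simp
  from this[of "[]"] show ?thesis using assms(2,3) by simp
qed

lemma inversion_sign_sorted: "sorted zs \<Longrightarrow> distinct zs \<Longrightarrow> inversion_sign zs = 1"
proof (induction zs)
  case (Cons z zs)
  then have "order_sgn z y = 1" if "y \<in> set zs" for y
    using that by (auto simp: order_sgn_def order.strict_iff_order)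
  then show ?case using Cons by simp
qed simp

text \<open>Both signs flip under an adjacent swap, so their product is constant, and on the
  increasing list both are 1.\<close>

lemma ordering_sign_inversion:
  assumes "distinct xs"
  shows "ordering_sign xs = inversion_sign xs"
proof -
  define ss where "ss = sorted_list_of_set (set xs)"
  have ss: "distinct ss" "sorted ss" "set ss = set xs" by (simp_all add: ss_def)
  have "inversion_sign ss = 1" using ss by (intro inversion_sign_sorted)
  moreover have "ordering_sign ss = 1"
  proof -
    have "ordering_sign ss = sign (id :: nat \<Rightarrow> nat)"
      by (rule ordering_sign_eq) (use ss in \<open>simp_all add: permutes_id ss_def\<close>)
    then show ?thesis by simp
  qed
  moreover have "ordering_sign xs * inversion_sign xs = ordering_sign ss * inversion_sign ss"
  proof (rule adjacent_swap_invariant[where h = "\<lambda>xs. ordering_sign xs * inversion_sign xs"])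
    show "mset xs = mset ss" using assms ss by (simp add: set_eq_iff_mset_eq_distinct)
  qed (use assms in \<open>simp_all add: ordering_sign_swap inversion_sign_swap\<close>)
  ultimately show ?thesis using ordering_sign_mem[OF assms] by auto
qed

text \<open>The relation for tuples is trivial if \<open>xs\<close> has a repetition, reduces to two
  cancelling terms if \<open>ys\<close> has one, and otherwise is the relation for the sets of
  entries.\<close>

lemma uniform_chirotopeI:
  fixes \<phi> :: "'v::{finite,linorder} list \<Rightarrow> int"
  assumes \<phi>: "\<And>xs. \<phi> xs = (if distinct xs then ordering_sign xs * G (set xs) else 0)"
    and G: "\<And>W. card W = r \<Longrightarrow> G W \<in> {-1, 1}" and three: "three_term r G"
    and r: "r \<le> CARD('v)"
  shows "uniform_chirotope r \<phi>"
proof -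
  have sign: "\<phi> xs \<in> {-1, 1}" if "distinct xs" "length xs = r" for xs
    using G[of "set xs"] ordering_sign_mem[OF that(1)] that by (auto simp: \<phi> distinct_card)
  obtain W :: "'v set" where W: "card W = r"
    using obtain_subset_with_card_n[OF r] by blast
  have "\<phi> (sorted_list_of_set W) \<in> {-1, 1}" by (rule sign) (use W in simp_all)
  then have nonzero: "\<exists>xs. length xs = r \<and> \<phi> xs \<noteq> 0"
    using W by (intro exI[of _ "sorted_list_of_set W"]) auto
  have alternating: "\<phi> (permute_list \<pi> xs) = sign \<pi> * \<phi> xs" if "length xs = r" "\<pi> permutes {..<r}" for xs \<pi>
    using that ordering_sign_permute[of xs \<pi>] by (auto simp: \<phi>)
  have gp: "(\<forall>k\<le>r. t k = 0) \<or> ((\<exists>k\<le>r. t k > 0) \<and> (\<exists>k\<le>r. t k < 0))"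
    if len: "Suc (length xs) = r" "length ys = Suc r"
      and t: "t = (\<lambda>k. (-1) ^ k * \<phi> (xs @ [ys ! k]) * \<phi> (take k ys @ drop (Suc k) ys))" for xs ys t
  proof -
    consider "\<not> distinct xs" | "distinct xs" "\<not> distinct ys" | "distinct xs" "distinct ys" by blast
    then show ?thesis
    proof cases
      case 1
      then show ?thesis by (simp add: t \<phi>)
    next
      \<comment> \<open>Deleting a position other than those of two equal entries leaves a
        repetition. The two remaining terms are opposite: moving \<open>v\<close> past
        \<open>ms\<close> costs \<open>(-1) ^ length ms\<close>, while the positions differ by
        \<open>Suc (length ms)\<close>.\<close>
      case 2
      obtain us v ms ws where ys: "ys = us @ v # ms @ v # ws"
        using not_distinct_decomp[OF 2(2)] by auto
      define i where "i = length us"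
      define j where "j = Suc (i + length ms)"
      have ij: "i \<le> r" "j \<le> r" "ys ! i = v" "ys ! j = v"
        using len(2) by (auto simp: ys i_def j_def nth_append)
      have Di: "take i ys @ drop (Suc i) ys = us @ ms @ v # ws"
        and Dj: "take j ys @ drop (Suc j) ys = us @ v # ms @ ws"
        by (simp_all add: ys i_def j_def)
      have zero: "t k = 0" if k: "k \<le> r" "k \<noteq> i" "k \<noteq> j" for k
      proof -
        let ?D = "take k ys @ drop (Suc k) ys"
        let ?p = "\<lambda>l. if l < k then l else l - 1"
        have nth: "?D ! ?p l = ys ! l" "?p l < length ?D" if "l \<noteq> k" "l \<le> r" for l
          using that k len(2) by (auto simp: nth_append)
        have ne: "i \<noteq> k" "j \<noteq> k" using k by simp_all
        have "?D ! ?p i = ?D ! ?p j"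
          unfolding nth(1)[OF ne(1) ij(1)] nth(1)[OF ne(2) ij(2)] ij(3,4) ..
        moreover have "?p i \<noteq> ?p j" using k by (auto simp: j_def)
        ultimately have "\<not> distinct ?D"
          using nth_eq_iff_index_eq[OF _ nth(2)[OF ne(1) ij(1)] nth(2)[OF ne(2) ij(2)]] by blast
        then have "\<phi> ?D = 0" unfolding \<phi> by (rule if_not_P)
        then show ?thesis by (simp add: t)
      qed
      have dist: "distinct (us @ ms @ v # ws) \<longleftrightarrow> distinct (us @ v # ms @ ws)" by auto
      have "\<phi> (us @ v # ms @ ws) = (-1) ^ length ms * \<phi> (us @ ms @ v # ws)"
      proof (cases "distinct (us @ v # ms @ ws)")
        case True
        have "inversion_sign (us @ v # ms @ ws)
            = (-1) ^ (length ms + length ws) * cross_sgn (set us \<union> set (ms @ ws)) v * inversion_sign (us @ ms @ ws)"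
          using inversion_sign_delete[OF True] by simp
        moreover have "inversion_sign ((us @ ms) @ v # ws)
            = (-1) ^ length ws * cross_sgn (set (us @ ms) \<union> set ws) v * inversion_sign ((us @ ms) @ ws)"
          by (rule inversion_sign_delete) (use True in auto)
        ultimately have "inversion_sign (us @ v # ms @ ws) = (-1) ^ length ms * inversion_sign (us @ ms @ v # ws)"
          by (simp add: power_add Un_assoc)
        moreover have "set (us @ v # ms @ ws) = set (us @ ms @ v # ws)" by auto
        ultimately show ?thesis
          using True dist by (simp only: \<phi> if_True ordering_sign_inversion mult.assoc)
      qed (use dist in \<open>simp only: \<phi> if_False mult_zero_right\<close>)
      then have "t j = - t i"
        unfolding t Di Dj ij(3,4) by (simp add: j_def power_add)
      then consider "t i = 0" "t j = 0" | "t i > 0" "t j < 0" | "t i < 0" "t j > 0" by linarith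
      then show ?thesis
      proof cases
        case 1
        then have "t k = 0" if "k \<le> r" for k
          using zero[OF that] by (cases "k = i \<or> k = j") auto
        then show ?thesis by blast
      qed (use ij in blast)+
    next
      case 3
      define X where "X = set xs"
      define Y where "Y = set ys"
      have X: "finite X" "Suc (card X) = r" and Y: "finite Y" "card Y = Suc r"
        using 3 len by (simp_all add: X_def Y_def distinct_card)
      \<comment> \<open>The sign common to all terms: position \<open>k\<close> has
        \<open>r - k\<close> entries after it, so deleting it turns \<open>(-1) ^ k\<close> into
        \<open>(-1) ^ r\<close>.\<close>
      define C where "C = (-1) ^ r * inversion_sign xs * inversion_sign ys"
      have inv: "inversion_sign xs \<in> {-1, 1}" "inversion_sign ys \<in> {-1, 1}"
        using ordering_sign_mem[OF 3(1)] ordering_sign_mem[OF 3(2)] 3 by (simp_all add: ordering_sign_inversion)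
      then have C: "C \<in> {-1, 1}"
        unfolding C_def by (cases "even r") auto
      have t_eq: "t k = C * gp_term G X Y (ys ! k)" if k: "k \<le> r" "ys ! k \<notin> X" for k
      proof -
        define v where "v = ys ! k"
        define us where "us = take k ys"
        define vs where "vs = drop (Suc k) ys"
        have ys: "ys = us @ v # vs" using k(1) len(2) by (simp add: id_take_nth_drop us_def v_def vs_def)
        have lvs: "r = k + length vs" using k(1) len(2) by (simp add: vs_def)
        have set: "set us \<union> set vs = Y - {v}" using 3(2) by (auto simp: Y_def ys)
        have "inversion_sign (xs @ [v]) = cross_sgn X v * inversion_sign xs"
          using inversion_sign_delete[of xs v "[]"] 3(1) k(2) by (simp add: X_def v_def)
        moreover have "distinct (xs @ [v])" using 3(1) k(2) by (simp add: X_def v_def)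
        ultimately have 1: "\<phi> (xs @ [v]) = cross_sgn X v * inversion_sign xs * G (insert v X)"
          by (simp add: \<phi> ordering_sign_inversion X_def)
        have "inversion_sign ys = (-1) ^ length vs * cross_sgn (Y - {v}) v * inversion_sign (us @ vs)"
          using inversion_sign_delete[of us v vs] 3(2) unfolding ys set by simp
        moreover have "((-1) ^ length vs) * ((-1) ^ length vs) = (1::int)"
          by (simp add: power_add[symmetric])
        ultimately have "inversion_sign (us @ vs) = (-1) ^ length vs * cross_sgn (Y - {v}) v * inversion_sign ys"
          using sign_square[OF cross_sgn_sign[of "Y - {v}" v]] by (simp add: algebra_simps)
        moreover have "distinct (us @ vs)" using 3(2) ys by simp
        ultimately have 2: "\<phi> (us @ vs) = (-1) ^ length vs * cross_sgn (Y - {v}) v * inversion_sign ys * G (Y - {v})"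
          using set by (simp add: \<phi> ordering_sign_inversion)
        show ?thesis
          unfolding t v_def[symmetric] us_def[symmetric] vs_def[symmetric] 1 2
          by (simp add: C_def gp_term_def lvs power_add mult_ac)
      qed
      obtain y z where yz: "y \<in> Y - X" "z \<in> Y - X" "gp_term G X Y y \<noteq> gp_term G X Y z"
        using gp_from_three_term[OF G three X Y] by blast
      have gp_sign: "gp_term G X Y y \<in> {-1, 1}" if "y \<in> Y - X" for y
        using that X Y G[of "insert y X"] G[of "Y - {y}"] cross_sgn_sign[of X y] cross_sgn_sign[of "Y - {y}" y]
        unfolding gp_term_def by auto
      obtain k l where kl: "k \<le> r" "l \<le> r" "y = ys ! k" "z = ys ! l"
        using yz(1,2) len(2) by (auto simp: Y_def in_set_conv_nth less_Suc_eq_le)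
      have "t k = C * gp_term G X Y y" "t l = C * gp_term G X Y z"
        using t_eq kl yz by auto
      moreover have "C * gp_term G X Y y = 1 \<and> C * gp_term G X Y z = -1 \<or> C * gp_term G X Y y = -1 \<and> C * gp_term G X Y z = 1"
        using gp_sign[OF yz(1)] gp_sign[OF yz(2)] yz(3) C by auto
      ultimately have "t k > 0 \<and> t l < 0 \<or> t k < 0 \<and> t l > 0" by linarith
      then show ?thesis using kl by blast
    qed
  qed
  have "\<phi> xs \<in> {-1, 0, 1}" if "length xs = r" for xs
    using sign[OF _ that] by (cases "distinct xs") (auto simp: \<phi>)
  moreover have "\<phi> xs \<noteq> 0" if "length xs = r" "distinct xs" for xs
    using sign[OF that(2,1)] by auto
  ultimately show ?thesis
    unfolding uniform_chirotope_def chirotope_def Let_def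
    using nonzero alternating gp by blast
qed

section \<open>Matchings and permutations\<close>

abbreviation enum :: "'q::{finite,linorder} list" where
  "enum \<equiv> sorted_list_of_set UNIV"

text \<open>Listing the rows increasingly and the columns in the order \<open>xs\<close> turns a
  matching into a permutation of positions; \<open>xs\<close> may be in any order.\<close>

lemma perfect_matching_permutation:
  fixes M :: "('q::{finite,linorder} \<times> 'v) set"
  assumes pm: "perfect_matching UNIV (set xs) M" and xs: "distinct xs"
  obtains \<pi> where "\<pi> permutes {..<length xs}" "\<And>i. i < length xs \<Longrightarrow> (enum ! i, xs ! \<pi> i) \<in> M"
    "length xs = CARD('q)"
proof -
  have ex: "\<exists>!v. (q, v) \<in> M" for q using pm by (simp add: perfect_matching_def)
  define m where "m q = (THE v. (q, v) \<in> M)" for q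
  have m: "(q, m q) \<in> M" for q unfolding m_def using theI'[OF ex] .
  have inj: "inj m"
  proof (rule injI)
    fix p q assume eq: "m p = m q"
    have "m p \<in> set xs" using pm m[of p] by (auto simp: perfect_matching_def)
    then have "\<exists>!q. (q, m p) \<in> M" using pm by (simp add: perfect_matching_def)
    moreover have "(p, m p) \<in> M" "(q, m p) \<in> M" using m[of p] m[of q] eq by simp_all
    ultimately show "p = q" by (metis (no_types))
  qed
  have "range m = set xs"
  proof
    show "range m \<subseteq> set xs" using m pm by (auto simp: perfect_matching_def)
    show "set xs \<subseteq> range m"
    proof
      fix v assume "v \<in> set xs"
      then obtain q where "(q, v) \<in> M" using pm by (auto simp: perfect_matching_def)
      then have "v = m q" using ex[of q] m[of q] by (metis (no_types))
      then show "v \<in> range m" by simp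
    qed
  qed
  then have set: "set (map m enum) = set xs" by simp
  have dist: "distinct (map m enum)" using inj by (simp add: distinct_map inj_on_subset)
  then have len: "length xs = CARD('q)"
    using distinct_card[OF dist] distinct_card[OF xs] set by simp
  obtain \<pi> where \<pi>: "\<pi> permutes {..<length xs}" "permute_list \<pi> xs = map m enum"
    by (rule distinct_permutation_exists[OF dist xs set])
  have "(enum ! i, xs ! \<pi> i) \<in> M" if "i < length xs" for i
  proof -
    have "xs ! \<pi> i = map m enum ! i" using permute_list_nth[OF \<pi>(1)] that \<pi>(2) by simp
    then show ?thesis using m that len by simp
  qed
  then show thesis using that[OF \<pi>(1) _ len] by simp
qed

lemma permutation_perfect_matching:
  assumes "distinct xs" "length xs = CARD('q::{finite,linorder})" "\<pi> permutes {..<length xs}"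
  shows "perfect_matching (UNIV :: 'q set) (set xs) ((\<lambda>i. (enum ! i, xs ! \<pi> i)) ` {..<length xs})"
proof -
  have len: "length (enum :: 'q list) = length xs" using assms(2) by simp
  have inj: "i = j" if "enum ! i = (enum ! j :: 'q)" "i < length xs" "j < length xs" for i j
    using that len nth_eq_iff_index_eq[of "enum :: 'q list" i j] by simp
  have \<pi>: "\<pi> i < length xs" if "i < length xs" for i
    using permutes_in_image[OF assms(3)] that by simp
  have inj': "i = j" if "xs ! \<pi> i = xs ! \<pi> j" "i < length xs" "j < length xs" for i j
  proof -
    have "\<pi> i = \<pi> j" using that \<pi> assms(1) nth_eq_iff_index_eq by metis
    then show ?thesis using permutes_inj[OF assms(3)] by (simp add: inj_eq)
  qed
  have "\<exists>!v. (q, v) \<in> (\<lambda>i. (enum ! i, xs ! \<pi> i)) ` {..<length xs}" for q :: 'q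
  proof -
    have "q \<in> set enum" by simp
    then obtain i where i: "i < length xs" "enum ! i = q" using len unfolding in_set_conv_nth by metis
    show ?thesis
    proof (rule ex1I[of _ "xs ! \<pi> i"])
      fix v assume "(q, v) \<in> (\<lambda>i. (enum ! i, xs ! \<pi> i)) ` {..<length xs}"
      then obtain j where "j < length xs" "q = enum ! j" "v = xs ! \<pi> j" by auto
      then show "v = xs ! \<pi> i" using inj[of i j] i by simp
    qed (use i in auto)
  qed
  moreover have "\<exists>!q::'q. (q, v) \<in> (\<lambda>i. (enum ! i, xs ! \<pi> i)) ` {..<length xs}" if v: "v \<in> set xs" for v
  proof -
    obtain k where k: "k < length xs" "xs ! k = v" using v unfolding in_set_conv_nth by metis
    obtain i where i: "i < length xs" "\<pi> i = k" using permutes_image[OF assms(3)] k(1) by (metis imageE lessThan_iff)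
    show ?thesis
    proof (rule ex1I[of _ "enum ! i"])
      fix q :: 'q assume "(q, v) \<in> (\<lambda>i. (enum ! i, xs ! \<pi> i)) ` {..<length xs}"
      then obtain j where "j < length xs" "q = enum ! j" "v = xs ! \<pi> j" by auto
      then show "q = enum ! i" using inj'[of i j] i k by simp
    qed (use i k in auto)
  qed
  ultimately show ?thesis using \<pi> by (auto simp: perfect_matching_def)
qed

text \<open>The value is one term of the determinant expansion for the columns \<open>xs\<close>.
  The factor \<open>ordering_sign xs\<close> of the alternating extension occurs again in the
  matching sign and squares to 1.\<close>

lemma induced_chirotope_permutation:
  fixes B :: "int ^ 'v::{finite,linorder} ^ 'q::{finite,linorder}"
  assumes M: "M (set xs) = (\<lambda>i. (enum ! i, xs ! \<pi> i)) ` {..<length xs}"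
    and xs: "distinct xs" "length xs = CARD('q)" and \<pi>: "\<pi> permutes {..<length xs}"
  shows "induced_chirotope M B xs = sign \<pi> * (\<Prod>i<length xs. B $ (enum ! i) $ (xs ! \<pi> i))"
proof -
  have pm: "perfect_matching UNIV (set xs) (M (set xs))"
    unfolding M by (rule permutation_perfect_matching[OF xs \<pi>])
  have "map (\<lambda>q. THE v. (q, v) \<in> M (set xs)) enum = permute_list \<pi> xs"
  proof (rule nth_equalityI)
    fix i assume "i < length (map (\<lambda>q. THE v. (q, v) \<in> M (set xs)) (enum :: 'q list))"
    then have i: "i < CARD('q)" by simp
    have "(THE v. (enum ! i, v) \<in> M (set xs)) = xs ! \<pi> i"
    proof (rule the1_equality)
      show "\<exists>!v. (enum ! i, v) \<in> M (set xs)" using pm by (simp add: perfect_matching_def)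
      show "(enum ! i, xs ! \<pi> i) \<in> M (set xs)" unfolding M using i xs(2) by auto
    qed
    then show "map (\<lambda>q. THE v. (q, v) \<in> M (set xs)) enum ! i = permute_list \<pi> xs ! i"
      using permute_list_nth[OF \<pi>] i xs(2) by simp
  qed (simp add: xs(2))
  then have "matching_sign (M (set xs)) = sign \<pi> * ordering_sign xs"
    unfolding matching_sign_def using ordering_sign_permute[OF xs(1) \<pi>] by simp
  moreover have "(\<Prod>(q, v)\<in>M (set xs). B $ q $ v) = (\<Prod>i<length xs. B $ (enum ! i) $ (xs ! \<pi> i))"
  proof -
    have "inj_on (\<lambda>i. (enum ! i :: 'q, xs ! \<pi> i)) {..<length xs}"
    proof (rule inj_onI)
      fix i j assume "i \<in> {..<length xs}" "j \<in> {..<length xs}"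
        "(enum ! i :: 'q, xs ! \<pi> i) = (enum ! j, xs ! \<pi> j)"
      then show "i = j" using xs(2) nth_eq_iff_index_eq[of "enum :: 'q list" i j] by simp
    qed
    then show ?thesis unfolding M by (simp add: prod.reindex)
  qed
  ultimately show ?thesis
    using ordering_sign_mem[OF xs(1)] xs(1) by (auto simp: induced_chirotope_def)
qed

section \<open>Exchanging two permutations along an alternating path\<close>

text \<open>The permutation \<open>\<pi>\<close> that carries \<open>p\<close> to the first
  exchanged map also carries the second exchanged map to \<open>q\<close>, because the images of
  \<open>P\<close> agree. Its sign cancels in the product.\<close>

lemma permutation_exchange:
  assumes p: "p permutes {..<r::nat}" "q permutes {..<r}" and P: "P \<subseteq> {..<r}" "p ` P = q ` P"
  shows "(\<lambda>i. if i \<in> P then q i else p i) permutes {..<r}" (is "?p' permutes _")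
    and "(\<lambda>i. if i \<in> P then p i else q i) permutes {..<r}" (is "?q' permutes _")
    and "sign (\<lambda>i. if i \<in> P then q i else p i) * sign (\<lambda>i. if i \<in> P then p i else q i) = sign p * sign q"
proof -
  have perm: "(\<lambda>i. if i \<in> P then q i else p i) permutes {..<r}"
    if p: "p permutes {..<r}" "q permutes {..<r}" and eq: "p ` P = q ` P" for p q :: "nat \<Rightarrow> nat"
  proof (rule bij_imp_permutes)
    have "inj_on (\<lambda>i. if i \<in> P then q i else p i) {..<r}"
    proof (rule inj_onI)
      fix i j assume ij: "(if i \<in> P then q i else p i) = (if j \<in> P then q j else p j)"
      have "p a \<noteq> q b" if "a \<notin> P" "b \<in> P" for a b
        using that eq permutes_inj[OF p(1)] by (metis imageE imageI inj_eq)
      then show "i = j"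
        using ij permutes_inj[OF p(1)] permutes_inj[OF p(2)] by (metis inj_eq)
    qed
    moreover have "(\<lambda>i. if i \<in> P then q i else p i) ` {..<r} \<subseteq> {..<r}"
      using permutes_in_image[OF p(1)] permutes_in_image[OF p(2)] by auto
    ultimately show "bij_betw (\<lambda>i. if i \<in> P then q i else p i) {..<r} {..<r}"
      by (metis bij_betw_def endo_inj_surj finite_lessThan)
    show "(if i \<in> P then q i else p i) = i" if "i \<notin> {..<r}" for i
      using that p P(1) by (metis permutes_not_in subsetD)
  qed
  show p': "?p' permutes {..<r}" using perm[OF p P(2)] .
  show q': "?q' permutes {..<r}" using perm[OF p(2,1) P(2)[symmetric]] .
  define \<pi> where "\<pi> = ?p' \<circ> inv p"
  have \<pi>: "\<pi> permutes {..<r}"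
    unfolding \<pi>_def by (intro permutes_compose permutes_inv p p')
  have 1: "\<pi> \<circ> p = ?p'"
    unfolding \<pi>_def by (simp add: comp_assoc permutes_inv_o[OF p(1)])
  have 2: "\<pi> \<circ> ?q' = q"
  proof
    fix i
    show "(\<pi> \<circ> ?q') i = q i"
    proof (cases "i \<in> P")
      case True
      then show ?thesis by (simp add: \<pi>_def permutes_inverses(2)[OF p(1)])
    next
      case False
      define j where "j = inv p (q i)"
      have j: "p j = q i" by (simp add: j_def permutes_inverses(1)[OF p(1)])
      have "j \<notin> P"
        using False j P(2) permutes_inj[OF p(2)] by (metis imageE imageI inj_eq)
      then show ?thesis using False j by (simp add: \<pi>_def j_def)
    qed
  qed
  have perm': "permutation f" if "f permutes {..<r}" for f
    using that permutation_permutes by blast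
  have "sign ?p' = sign \<pi> * sign p" "sign q = sign \<pi> * sign ?q'"
    using sign_compose[OF perm'[OF \<pi>] perm'[OF p(1)]] sign_compose[OF perm'[OF \<pi>] perm'[OF q']] 1 2 by simp_all
  then show "sign ?p' * sign ?q' = sign p * sign q" by simp
qed

text \<open>In the union of two matchings given by \<open>p\<close> and \<open>q\<close>, \<open>P\<close> is the set of nodes on the path that
  starts at the value \<open>Suc m\<close> of \<open>p\<close>; it ends at one of the values \<open>m\<close> and \<open>Suc m\<close> of \<open>q\<close>.\<close>
lemma alternating_path:
  assumes p: "p permutes {..<Suc (Suc m)}" and q: "q permutes {..<Suc (Suc m)}"
  obtains P where "P \<subseteq> {..<Suc (Suc m)}" "Suc m \<in> p ` P" "m \<notin> p ` P"
    "q ` P = p ` P \<or> (Transposition.transpose m (Suc m) \<circ> q) ` P = p ` P"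
proof -
  define P where "P = \<Inter>{Q. inv p (Suc m) \<in> Q \<and> (\<forall>i\<in>Q. q i < m \<longrightarrow> inv p (q i) \<in> Q)}"
  have start: "inv p (Suc m) \<in> P" by (simp add: P_def)
  have step: "inv p (q i) \<in> P" if "i \<in> P" "q i < m" for i
    using that by (simp add: P_def)
  have least: "P \<subseteq> Q" if "inv p (Suc m) \<in> Q" "\<And>i. i \<in> Q \<Longrightarrow> q i < m \<Longrightarrow> inv p (q i) \<in> Q" for Q
    unfolding P_def by (rule Inter_lower) (use that in simp)
  have inv_p: "p (inv p v) = v" for v using permutes_inverses(1)[OF p] .
  have "inv p v < Suc (Suc m)" if "v < Suc (Suc m)" for v
    using permutes_in_image[OF permutes_inv[OF p], of v] that by simp
  then have P: "P \<subseteq> {..<Suc (Suc m)}" by (intro least) auto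
  \<comment> \<open>Minimality of \<open>P\<close>: every member except the start has a predecessor
    on the path.\<close>
  have "P \<subseteq> insert (inv p (Suc m)) {inv p (q i) | i. i \<in> P \<and> q i < m}"
  proof (rule least)
    fix i assume i: "i \<in> insert (inv p (Suc m)) {inv p (q i) | i. i \<in> P \<and> q i < m}" "q i < m"
    then have "i \<in> P" using start step by auto
    then show "inv p (q i) \<in> insert (inv p (Suc m)) {inv p (q i) | i. i \<in> P \<and> q i < m}" using i(2) by blast
  qed simp
  note generated = this
  have image: "p ` P = insert (Suc m) (q ` P \<inter> {..<m})"
  proof (intro equalityI subsetI)
    fix v assume "v \<in> p ` P"
    then obtain i where i: "i \<in> P" "v = p i" by auto
    from subsetD[OF generated i(1)] consider "i = inv p (Suc m)" | j where "j \<in> P" "q j < m" "i = inv p (q j)"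
      by auto
    then show "v \<in> insert (Suc m) (q ` P \<inter> {..<m})"
      by cases (simp_all add: i(2) inv_p)
  next
    fix v assume "v \<in> insert (Suc m) (q ` P \<inter> {..<m})"
    then consider "v = Suc m" | j where "j \<in> P" "q j < m" "v = q j" by auto
    then show "v \<in> p ` P"
    proof cases
      case 1
      then show ?thesis using imageI[OF start, of p] by (simp add: inv_p)
    next
      case 2
      then show ?thesis using imageI[OF step[OF 2(1,2)], of p] by (simp add: inv_p)
    qed
  qed
  have fin: "finite P" using P finite_subset by blast
  have "card (p ` P) = card P" "card (q ` P) = card P"
    using card_image inj_on_subset permutes_inj p q by (metis subset_UNIV)+
  moreover have "card (p ` P) = Suc (card (q ` P \<inter> {..<m}))"
    unfolding image by (subst card_insert_disjoint) (use fin in auto)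
  moreover have "card (q ` P) = card (q ` P \<inter> {..<m}) + card (q ` P - {..<m})"
    using card_Int_Diff[of "q ` P" "{..<m}"] fin by simp
  \<comment> \<open>By injectivity \<open>q\<close> takes exactly one value outside
    \<open>{..<m}\<close> on \<open>P\<close>; this value is the end of the path.\<close>
  ultimately have "card (q ` P - {..<m}) = 1" by simp
  then obtain v where v: "q ` P - {..<m} = {v}" by (auto simp: card_1_singleton_iff)
  have "q ` P \<subseteq> {..<Suc (Suc m)}" using P permutes_image[OF q] by blast
  moreover have "v \<in> q ` P - {..<m}" using v by simp
  ultimately have "v = m \<or> v = Suc m" by (auto simp: less_Suc_eq)
  have qP: "q ` P = insert v (q ` P \<inter> {..<m})" using v by auto
  have tr: "Transposition.transpose m (Suc m) ` (q ` P \<inter> {..<m}) = q ` P \<inter> {..<m}"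
    by (auto simp: Transposition.transpose_def image_iff)
  have "q ` P = p ` P \<or> (Transposition.transpose m (Suc m) \<circ> q) ` P = p ` P"
    using \<open>v = m \<or> v = Suc m\<close>
  proof
    assume "v = m"
    then have "Transposition.transpose m (Suc m) ` (q ` P) = p ` P"
      by (subst qP) (simp only: image_insert tr image Transposition.transpose_apply_first)
    then show ?thesis by (simp add: image_comp)
  next
    assume "v = Suc m"
    then show ?thesis using qP image by simp
  qed
  moreover have "Suc m \<in> p ` P" "m \<notin> p ` P" unfolding image by auto
  ultimately show thesis using that P by blast
qed

section \<open>The induced chirotope is uniform\<close>

text \<open>A perfect matching inside any tree of the family is the one of the matching field, so
  values can be read off from permutations with edges in \<open>F\<close>.\<close>

lemma induced_chirotope_family:
  fixes \<F> :: "('q::{finite,linorder} \<times> 'v::{finite,linorder}) set set" and B :: "int ^ 'v::{finite,linorder} ^ 'q::{finite,linorder}"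
  assumes fam: "matching_family \<F>" "F \<in> \<F>" and xs: "distinct xs" "length xs = CARD('q)"
    and \<pi>: "\<pi> permutes {..<length xs}" "\<And>i. i < length xs \<Longrightarrow> (enum ! i, xs ! \<pi> i) \<in> F"
  shows "induced_chirotope (matching_field \<F>) B xs = sign \<pi> * (\<Prod>i<length xs. B $ (enum ! i) $ (xs ! \<pi> i))"
proof (rule induced_chirotope_permutation[OF _ xs \<pi>(1)])
  show "matching_field \<F> (set xs) = (\<lambda>i. (enum ! i, xs ! \<pi> i)) ` {..<length xs}"
    by (rule matching_family.matching_field_eqI[OF fam(1) permutation_perfect_matching[OF xs \<pi>(1)] fam(2)])
      (use \<pi>(2) in auto)
qed

lemma matching_field_permutation:
  fixes \<F> :: "('q::{finite,linorder} \<times> 'v::{finite,linorder}) set set"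
  assumes fam: "matching_family \<F>" and xs: "distinct xs" "length xs = CARD('q)"
  obtains \<pi> where "\<pi> permutes {..<length xs}"
    "\<And>i. i < length xs \<Longrightarrow> (enum ! i, xs ! \<pi> i) \<in> matching_field \<F> (set xs)"
proof -
  have "card (set xs) = CARD('q)" using xs by (simp add: distinct_card)
  from matching_family.matching_field(1)[OF fam this] show thesis
    using perfect_matching_permutation[OF _ xs(1)] that by metis
qed

lemma induced_chirotope_swap:
  assumes "distinct (l @ [a, b])"
  shows "induced_chirotope M B (l @ [b, a]) = - induced_chirotope M B (l @ [a, b])"
proof -
  have "set (l @ [b, a]) = set (l @ [a, b])" "distinct (l @ [b, a])" using assms by auto
  then show ?thesis
    using ordering_sign_swap[of l a b "[]"] assms unfolding induced_chirotope_def by simp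
qed

text \<open>Exchanging \<open>p\<close> and \<open>q\<close> on \<open>P\<close> trades
  \<open>b\<close> for \<open>c\<close> and keeps \<open>a\<close> and \<open>d\<close>. All edges
  stay in \<open>F\<close>, so the results are again matchings of the field; the matrix entries are
  the same overall, and the product of the signs is preserved.\<close>

lemma chirotope_exchange_last:
  fixes \<F> :: "('q::{finite,linorder} \<times> 'v::{finite,linorder}) set set" and B :: "int ^ 'v::{finite,linorder} ^ 'q::{finite,linorder}"
  defines "\<phi> \<equiv> induced_chirotope (matching_field \<F>) B"
  assumes fam: "matching_family \<F>" "F \<in> \<F>" and dist: "distinct (l @ [a, b, c, d])"
    and len: "Suc (Suc (length l)) = CARD('q)"
    and p: "p permutes {..<Suc (Suc (length l))}" "\<And>i. i < Suc (Suc (length l)) \<Longrightarrow> (enum ! i, (l @ [a, b]) ! p i) \<in> F"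
    and q: "q permutes {..<Suc (Suc (length l))}" "\<And>i. i < Suc (Suc (length l)) \<Longrightarrow> (enum ! i, (l @ [d, c]) ! q i) \<in> F"
    and P: "P \<subseteq> {..<Suc (Suc (length l))}" "q ` P = p ` P" "Suc (length l) \<in> p ` P" "length l \<notin> p ` P"
  shows "\<phi> (l @ [a, b]) * \<phi> (l @ [d, c]) = \<phi> (l @ [a, c]) * \<phi> (l @ [d, b])"
proof -
  let ?r = "Suc (Suc (length l))"
  define p' where "p' = (\<lambda>i. if i \<in> P then q i else p i)"
  define q' where "q' = (\<lambda>i. if i \<in> P then p i else q i)"
  note ex = permutation_exchange[OF p(1) q(1) P(1) P(2)[symmetric], folded p'_def q'_def]
  \<comment> \<open>Positions in the image of \<open>P\<close> avoid the first free entry and all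
    others avoid the last, so the entry varied in each claim is not read.\<close>
  have agree: "(l @ [x, u]) ! k = (l @ [y, u]) ! k" if "k \<in> p ` P" "k < ?r" for x y u k
  proof -
    have "k \<noteq> length l" using that(1) P(4) by metis
    then show ?thesis using that(2) by (auto simp: nth_append less_Suc_eq)
  qed
  have agree': "(l @ [x, u]) ! k = (l @ [x, y]) ! k" if "k \<notin> p ` P" "k < ?r" for x y u k
  proof -
    have "k \<noteq> Suc (length l)" using that(1) P(3) by metis
    then show ?thesis using that(2) by (auto simp: nth_append less_Suc_eq)
  qed
  have bound: "p i < ?r" "q i < ?r" if "i < ?r" for i
    using permutes_in_image[OF p(1), of i] permutes_in_image[OF q(1), of i] that by simp_all
  have not_image: "p i \<notin> p ` P" "q i \<notin> p ` P" if "i \<notin> P" for i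
    using that permutes_inj[OF p(1)] permutes_inj[OF q(1)] P(2) by (auto simp: inj_image_mem_iff) (metis inj_image_mem_iff)
  have image: "p i \<in> p ` P" "q i \<in> p ` P" if "i \<in> P" for i
    using that P(2) by blast+
  have in_P: "(l @ [a, c]) ! p' i = (l @ [d, c]) ! q i" "(l @ [d, b]) ! q' i = (l @ [a, b]) ! p i" if "i \<in> P" "i < ?r" for i
    using that agree[OF image(2)[OF that(1)] bound(2)[OF that(2)]] agree[OF image(1)[OF that(1)] bound(1)[OF that(2)]]
    unfolding p'_def q'_def by (metis, metis)
  have off_P: "(l @ [a, c]) ! p' i = (l @ [a, b]) ! p i" "(l @ [d, b]) ! q' i = (l @ [d, c]) ! q i" if "i \<notin> P" "i < ?r" for i
    using that agree'[OF not_image(1)[OF that(1)] bound(1)[OF that(2)]] agree'[OF not_image(2)[OF that(1)] bound(2)[OF that(2)]]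
    unfolding p'_def q'_def by (metis, metis)
  have p'F: "(enum ! i, (l @ [a, c]) ! p' i) \<in> F" and q'F: "(enum ! i, (l @ [d, b]) ! q' i) \<in> F" if "i < ?r" for i
    using in_P[OF _ that] off_P[OF _ that] p(2)[OF that] q(2)[OF that] by metis+
  define w where "w xs \<pi> = (\<Prod>i<?r. B $ (enum ! i) $ (xs ! \<pi> i))" for xs and \<pi> :: "nat \<Rightarrow> nat"
  have val: "\<phi> (l @ [x, y]) = sign \<pi> * w (l @ [x, y]) \<pi>"
    if "\<pi> permutes {..<?r}" "\<And>i. i < ?r \<Longrightarrow> (enum ! i, (l @ [x, y]) ! \<pi> i) \<in> F" "distinct (l @ [x, y])" for x y \<pi>
    using induced_chirotope_family[OF fam that(3), of \<pi> B] that(1,2) len by (simp add: \<phi>_def w_def)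
  have "w (l @ [a, b]) p * w (l @ [d, c]) q = w (l @ [a, c]) p' * w (l @ [d, b]) q'"
    unfolding w_def prod.distrib[symmetric]
  proof (rule prod.cong[OF refl])
    fix i assume "i \<in> {..<?r}"
    then have i: "i < ?r" by simp
    show "B $ (enum ! i) $ ((l @ [a, b]) ! p i) * B $ (enum ! i) $ ((l @ [d, c]) ! q i)
        = B $ (enum ! i) $ ((l @ [a, c]) ! p' i) * B $ (enum ! i) $ ((l @ [d, b]) ! q' i)"
    proof (cases "i \<in> P")
      case True
      then show ?thesis using in_P[OF True i] by (simp only: mult.commute)
    next
      case False
      then show ?thesis using off_P[OF False i] by (simp only:)
    qed
  qed
  moreover have "\<phi> (l @ [a, b]) = sign p * w (l @ [a, b]) p" "\<phi> (l @ [d, c]) = sign q * w (l @ [d, c]) q"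
    "\<phi> (l @ [a, c]) = sign p' * w (l @ [a, c]) p'" "\<phi> (l @ [d, b]) = sign q' * w (l @ [d, b]) q'"
    using val[OF p] val[OF q] val[OF ex(1) p'F] val[OF ex(2) q'F] dist by auto
  ultimately show ?thesis using ex(3) by (simp add: mult_ac)
qed

text \<open>The path that starts at \<open>b\<close> ends at \<open>c\<close> or at
  \<open>d\<close>; the two ends give the two alternatives.\<close>

lemma chirotope_exchange:
  fixes \<F> :: "('q::{finite,linorder} \<times> 'v::{finite,linorder}) set set" and B :: "int ^ 'v::{finite,linorder} ^ 'q::{finite,linorder}"
  defines "\<phi> \<equiv> induced_chirotope (matching_field \<F>) B"
  assumes fam: "matching_family \<F>" "F \<in> \<F>" and dist: "distinct (l @ [a, b, c, d])"
    and len: "length l + 2 = CARD('q)"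
    and sub: "matching_field \<F> (set (l @ [a, b])) \<subseteq> F" "matching_field \<F> (set (l @ [c, d])) \<subseteq> F"
  shows "\<phi> (l @ [a, b]) * \<phi> (l @ [c, d]) = \<phi> (l @ [a, c]) * \<phi> (l @ [b, d]) \<or>
    \<phi> (l @ [a, b]) * \<phi> (l @ [c, d]) = - (\<phi> (l @ [a, d]) * \<phi> (l @ [b, c]))"
proof -
  let ?m = "length l"
  have len': "Suc (Suc ?m) = CARD('q)" using len by simp
  obtain p where p: "p permutes {..<Suc (Suc ?m)}" "\<And>i. i < Suc (Suc ?m) \<Longrightarrow> (enum ! i, (l @ [a, b]) ! p i) \<in> F"
  proof -
    have "distinct (l @ [a, b])" "length (l @ [a, b]) = CARD('q)" using dist len' by auto
    from matching_field_permutation[OF fam(1) this] obtain \<pi> where "\<pi> permutes {..<length (l @ [a, b])}"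
      "\<And>i. i < length (l @ [a, b]) \<Longrightarrow> (enum ! i, (l @ [a, b]) ! \<pi> i) \<in> matching_field \<F> (set (l @ [a, b]))"
      by metis
    then show thesis using sub(1) by (intro that[of \<pi>]) auto
  qed
  \<comment> \<open>Listing \<open>d\<close> before \<open>c\<close> puts \<open>b\<close> and
    \<open>c\<close> in the same position, as the exchange requires when the path ends at
    \<open>c\<close>.\<close>
  obtain q where q: "q permutes {..<Suc (Suc ?m)}" "\<And>i. i < Suc (Suc ?m) \<Longrightarrow> (enum ! i, (l @ [d, c]) ! q i) \<in> F"
  proof -
    have "set (l @ [d, c]) = set (l @ [c, d])" by auto
    moreover have "distinct (l @ [d, c])" "length (l @ [d, c]) = CARD('q)" using dist len' by auto
    from matching_field_permutation[OF fam(1) this] obtain \<pi> where "\<pi> permutes {..<length (l @ [d, c])}"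
      "\<And>i. i < length (l @ [d, c]) \<Longrightarrow> (enum ! i, (l @ [d, c]) ! \<pi> i) \<in> matching_field \<F> (set (l @ [d, c]))"
      by metis
    ultimately show thesis using sub(2) by (intro that[of \<pi>]) auto
  qed
  obtain P where P: "P \<subseteq> {..<Suc (Suc ?m)}" "Suc ?m \<in> p ` P" "?m \<notin> p ` P"
    "q ` P = p ` P \<or> (Transposition.transpose ?m (Suc ?m) \<circ> q) ` P = p ` P"
    by (rule alternating_path[OF p(1) q(1)])
  have swaps: "\<phi> (l @ [d, c]) = - \<phi> (l @ [c, d])" "\<phi> (l @ [d, b]) = - \<phi> (l @ [b, d])" "\<phi> (l @ [c, b]) = - \<phi> (l @ [b, c])"
    unfolding \<phi>_def by (rule induced_chirotope_swap; use dist in auto)+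
  from P(4) show ?thesis
  proof
    assume "q ` P = p ` P"
    from chirotope_exchange_last[OF fam dist len' p q P(1) this P(2,3), where B = B, folded \<phi>_def]
    show ?thesis unfolding swaps by simp
  next
    \<comment> \<open>The path ends at \<open>d\<close>: interchanging the roles of \<open>c\<close>
      and \<open>d\<close> brings this end to the last position.\<close>
    assume eq: "(Transposition.transpose ?m (Suc ?m) \<circ> q) ` P = p ` P"
    define q' where "q' = Transposition.transpose ?m (Suc ?m) \<circ> q"
    have q': "q' permutes {..<Suc (Suc ?m)}"
      unfolding q'_def by (intro permutes_compose q(1) permutes_swap_id) auto
    have nth: "(l @ [c, d]) ! Transposition.transpose ?m (Suc ?m) k = (l @ [d, c]) ! k" if "k < Suc (Suc ?m)" for k
      using that by (auto simp: Transposition.transpose_def nth_append less_Suc_eq)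
    have "(enum ! i, (l @ [c, d]) ! q' i) \<in> F" if "i < Suc (Suc ?m)" for i
      using nth[of "q i"] q(2)[OF that] permutes_in_image[OF q(1), of i] that by (simp add: q'_def)
    from chirotope_exchange_last[OF fam _ len' p q' this P(1) _ P(2,3), where B = B, folded \<phi>_def]
    show ?thesis using eq dist unfolding swaps by (auto simp: q'_def)
  qed
qed

text \<open>Each value is a sign because only entries of \<open>B\<close> on edges of one tree
  enter. If a three-term relation failed, its three nonzero terms would agree, whereas an exchange
  in a common tree makes two of them opposite.\<close>

lemma uniform_chirotope_family:
  fixes \<F> :: "('q::{finite,linorder} \<times> 'v::{finite,linorder}) set set" and B :: "int ^ 'v::{finite,linorder} ^ 'q::{finite,linorder}"
  assumes fam: "matching_family \<F>" and B: "\<And>F q v. F \<in> \<F> \<Longrightarrow> (q, v) \<in> F \<Longrightarrow> B $ q $ v \<in> {-1, 1}"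
    and card: "CARD('q) \<le> CARD('v)"
  shows "uniform_chirotope CARD('q) (induced_chirotope (matching_field \<F>) B)"
proof (rule uniform_chirotopeI[OF _ _ _ card])
  define \<phi> where "\<phi> = induced_chirotope (matching_field \<F>) B"
  define G where "G W = matching_sign (matching_field \<F> W) * (\<Prod>(q, v)\<in>matching_field \<F> W. B $ q $ v)" for W
  show \<phi>G: "induced_chirotope (matching_field \<F>) B xs = (if distinct xs then ordering_sign xs * G (set xs) else 0)" for xs
    by (simp add: induced_chirotope_def G_def)
  have sign: "\<phi> xs \<in> {-1, 1}" if xs: "distinct xs" "length xs = CARD('q)" for xs
  proof -
    have "card (set xs) = CARD('q)" using xs by (simp add: distinct_card)
    then obtain F where F: "F \<in> \<F>" "matching_field \<F> (set xs) \<subseteq> F"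
      using matching_family.matching_field(2)[OF fam] by blast
    obtain \<pi> where \<pi>: "\<pi> permutes {..<length xs}"
      "\<And>i. i < length xs \<Longrightarrow> (enum ! i, xs ! \<pi> i) \<in> matching_field \<F> (set xs)"
      using matching_field_permutation[OF fam xs] by metis
    have \<pi>F: "(enum ! i, xs ! \<pi> i) \<in> F" if "i < length xs" for i using \<pi>(2)[OF that] F(2) by blast
    have "(\<Prod>i<length xs. B $ (enum ! i) $ (xs ! \<pi> i)) \<in> {-1, 1}"
      by (rule sign_prod) (use B[OF F(1) \<pi>F] in simp)
    moreover have "sign \<pi> \<in> {-1, 1}" by (rule sign_mem)
    moreover have "\<phi> xs = sign \<pi> * (\<Prod>i<length xs. B $ (enum ! i) $ (xs ! \<pi> i))"
      unfolding \<phi>_def by (rule induced_chirotope_family[OF fam F(1) xs \<pi>(1) \<pi>F])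
    ultimately show ?thesis by auto
  qed
  show "G W \<in> {-1, 1}" if W: "card W = CARD('q)" for W
  proof -
    have "\<phi> (sorted_list_of_set W) \<in> {-1, 1}" by (rule sign) (use W in simp_all)
    moreover have "\<phi> (sorted_list_of_set W) = ordering_sign (sorted_list_of_set W) * G W"
      by (simp add: \<phi>_def \<phi>G)
    ultimately show ?thesis
      using ordering_sign_mem[of "sorted_list_of_set W"] by auto
  qed
  show "three_term CARD('q) G"
    unfolding three_term_def Let_def
  proof (intro allI impI notI)
    fix S :: "'v set" and a b c d
    assume S: "card S + 2 = CARD('q)" and abcd: "distinct [a, b, c, d]" "S \<inter> {a, b, c, d} = {}"
    define p where "p x y = G (insert x (insert y S)) * order_sgn x y" for x y
    assume "G (insert a (insert b S)) * order_sgn a b * (G (insert c (insert d S)) * order_sgn c d) =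
        - (G (insert a (insert c S)) * order_sgn a c * (G (insert b (insert d S)) * order_sgn b d)) \<and>
        G (insert a (insert b S)) * order_sgn a b * (G (insert c (insert d S)) * order_sgn c d) =
        G (insert a (insert d S)) * order_sgn a d * (G (insert b (insert c S)) * order_sgn b c)"
    then have bad: "p a b * p c d = - (p a c * p b d)" "p a b * p c d = p a d * p b c"
      unfolding p_def by blast+
    define l where "l = sorted_list_of_set S"
    have l: "distinct l" "set l = S" "length l + 2 = CARD('q)" using S by (simp_all add: l_def)
    define f where "f x y = \<phi> (l @ [x, y])" for x y
    have f: "f x y = inversion_sign l * (cross_sgn S x * cross_sgn S y * p x y)" if "x \<notin> S" "y \<notin> S" "x \<noteq> y" for x y
    proof -
      have d: "distinct (l @ [x, y])" using that l by auto
      have "inversion_sign (l @ [x, y]) = cross_sgn (insert x S) y * inversion_sign (l @ [x])"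
        using inversion_sign_delete[of "l @ [x]" y "[]"] d l(2) by simp
      also have "\<dots> = order_sgn x y * cross_sgn S y * (cross_sgn S x * inversion_sign l)"
        using inversion_sign_delete[of l x "[]"] d l that by (simp add: cross_sgn_insert)
      finally have "ordering_sign (l @ [x, y]) = order_sgn x y * cross_sgn S y * (cross_sgn S x * inversion_sign l)"
        using ordering_sign_inversion[OF d] by simp
      moreover have "set (l @ [x, y]) = insert x (insert y S)" using l by auto
      ultimately show ?thesis using d by (simp add: f_def \<phi>_def \<phi>G p_def mult_ac)
    qed
    \<comment> \<open>Each of the three products contains each of \<open>a, b, c, d\<close> once, so
      the cross signs with \<open>S\<close> form a common factor.\<close>
    define C where "C = cross_sgn S a * cross_sgn S b * cross_sgn S c * cross_sgn S d"
    have square: "inversion_sign l * inversion_sign l = 1"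
      using ordering_sign_inversion[OF l(1)] ordering_sign_mem[OF l(1)] sign_square by metis
    have fC: "f a b * f c d = C * (p a b * p c d)" "f a c * f b d = C * (p a c * p b d)" "f a d * f b c = C * (p a d * p b c)"
      using abcd by (simp_all add: f square C_def mult_ac)
    have nz: "f x y \<noteq> 0" if "x \<notin> S" "y \<notin> S" "x \<noteq> y" for x y
      using sign[of "l @ [x, y]"] that l by (auto simp: f_def)
    have sw: "f y x = - f x y" if "x \<notin> S" "y \<notin> S" "x \<noteq> y" for x y
      unfolding f_def \<phi>_def by (rule induced_chirotope_swap) (use that l in auto)
    have P: "f a b * f c d \<noteq> 0" "f a b * f c d = - (f a c * f b d)" "f a b * f c d = f a d * f b c"
      using bad nz abcd fC by auto
    have card4: "card {a, b, c, d} = 4" using abcd(1) by simp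
    obtain F \<sigma> \<tau> where F: "F \<in> \<F>" and st: "\<sigma> \<union> \<tau> = S \<union> {a, b, c, d}" "\<sigma> \<inter> \<tau> = S" "card \<sigma> = CARD('q)" "card \<tau> = CARD('q)"
      and sub: "matching_field \<F> \<sigma> \<subseteq> F" "matching_field \<F> \<tau> \<subseteq> F"
      by (rule matching_family.compatible_matchings[OF fam S card4 abcd(2)])
    have exch: "f x y * f z w = f x z * f y w \<or> f x y * f z w = - (f x w * f y z)"
      if "{x, y, z, w} = {a, b, c, d}" "distinct [x, y, z, w]"
        "matching_field \<F> (insert x (insert y S)) \<subseteq> F" "matching_field \<F> (insert z (insert w S)) \<subseteq> F" for x y z w
    proof -
      have "{x, y, z, w} \<inter> S = {}" using that(1) abcd(2) by auto
      then have "distinct (l @ [x, y, z, w])" using that(2) l by auto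
      moreover have "set (l @ [x, y]) = insert x (insert y S)" "set (l @ [z, w]) = insert z (insert w S)" using l by auto
      ultimately show ?thesis
        unfolding f_def \<phi>_def using chirotope_exchange[OF fam F _ l(3)] that(3,4) by metis
    qed
    \<comment> \<open>Each of the three possible partners of \<open>a\<close> in
      \<open>\<sigma>\<close> leads to a contradiction; the case that \<open>a\<close> lies in
      \<open>\<tau>\<close> follows by exchanging the two sets.\<close>
    have main: False
      if st: "\<sigma> \<union> \<tau> = S \<union> {a, b, c, d}" "\<sigma> \<inter> \<tau> = S" "card \<sigma> = CARD('q)" "a \<in> \<sigma>"
      and sub: "matching_field \<F> \<sigma> \<subseteq> F" "matching_field \<F> \<tau> \<subseteq> F" for \<sigma> \<tau>
    proof -
      have "S \<subseteq> \<sigma>" using st(2) by blast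
      then have "card (\<sigma> - S) = 2" using st(3) S by (simp add: card_Diff_subset)
      moreover have "a \<in> \<sigma> - S" using st(4) abcd(2) by auto
      ultimately have "card (\<sigma> - S - {a}) = 1" by simp
      then obtain x where "\<sigma> - S - {a} = {x}" by (rule card_1_singletonE)
      then have x: "\<sigma> - S = {a, x}" "x \<noteq> a" using \<open>a \<in> \<sigma> - S\<close> by auto
      then have \<sigma>: "\<sigma> = insert a (insert x S)" using \<open>S \<subseteq> \<sigma>\<close> by blast
      have \<tau>: "\<tau> = S \<union> ({a, b, c, d} - {a, x})" using st(1,2) x abcd(2) by blast
      have "x \<in> {b, c, d}" using x st(1) by blast
      then consider "x = b" | "x = c" | "x = d" by blast
      then show False
      proof cases
        case 1
        have "\<tau> = insert c (insert d S)" using abcd unfolding \<tau> 1 by auto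
        then show False
          using exch[of a b c d] sub abcd P \<sigma> 1 by auto
      next
        case 2
        have "\<tau> = insert b (insert d S)" using abcd unfolding \<tau> 2 by auto
        then have "f a c * f b d = f a b * f c d \<or> f a c * f b d = - (f a d * f c b)"
          using sub abcd(1) unfolding \<sigma> 2 by (intro exch) auto
        then show False using P sw[of b c] abcd by auto
      next
        case 3
        have "\<tau> = insert b (insert c S)" using abcd unfolding \<tau> 3 by auto
        then have "f a d * f b c = f a b * f d c \<or> f a d * f b c = - (f a c * f d b)"
          using sub abcd(1) unfolding \<sigma> 3 by (intro exch) auto
        then show False using P sw[of c d] sw[of b d] abcd by auto
      qed
    qed
    have "a \<in> \<sigma> \<or> a \<in> \<tau>" using st(1) by blast
    then show False
      using main[of \<sigma> \<tau>] main[of \<tau> \<sigma>] st sub by (simp add: Un_commute Int_commute) blast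
  qed
qed

section \<open>Duality\<close>

text \<open>Geometry gives real weightings. Since the trees are forests, integral marginals make
  them integral, so taking floors loses nothing.\<close>

lemma triangulation_tree_family:
  fixes T :: "((real ^ 'r::finite) \<times> (real ^ 'e::finite)) set set"
  assumes T: "product_triangulation T"
  shows "tree_family (simplex_tree ` T)"
proof
  show "bipartite_forest F" if "F \<in> simplex_tree ` T" for F
    using that simplex_tree_forest[OF T] by blast
  have real: "transport F (\<lambda>x. real (a x)) (\<lambda>y. real (b y)) (\<lambda>e. real (l e))" if "transport F a b l" for F a b and l :: "'r \<times> 'e \<Rightarrow> nat"
    using that unfolding transport_def by (auto simp flip: of_nat_sum simp del: split_paired_All)
  show "l = l'" if F: "F \<in> simplex_tree ` T" "F' \<in> simplex_tree ` T" and l: "transport F a b l" "transport F' a b l'"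
    for F F' a b and l l' :: "_ \<Rightarrow> nat"
  proof -
    obtain S S' where S: "S \<in> T" "F = simplex_tree S" and S': "S' \<in> T" "F' = simplex_tree S'" using F by blast
    have "(\<lambda>e. real (l e)) = (\<lambda>e. real (l' e))"
      by (rule product_triangulation_unique[OF T S(1) S'(1) real[OF l(1)[unfolded S(2)]] real[OF l(2)[unfolded S'(2)]]])
    then have "real (l e) = real (l' e)" for e by (rule fun_cong)
    then show ?thesis by (intro ext) simp
  qed
  show "\<exists>F\<in>simplex_tree ` T. \<exists>l::_ \<Rightarrow> nat. transport F a b l" if eq: "sum a UNIV = sum b UNIV" for a b
  proof -
    have "(\<Sum>i\<in>UNIV. real (a i)) = (\<Sum>j\<in>UNIV. real (b j))"
      using eq by (simp flip: of_nat_sum)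
    from product_triangulation_cover[OF T _ _ this]
    obtain S l where S: "S \<in> T" and l: "transport (simplex_tree S) (\<lambda>i. real (a i)) (\<lambda>j. real (b j)) l" by auto
    have "l e \<in> \<int>" for e
      by (rule forest_weights_integral[OF simplex_tree_forest[OF T S]])
        (use l in \<open>auto simp: transport_def simp del: split_paired_All\<close>)
    moreover have nonneg: "0 \<le> l e" and zero: "e \<notin> simplex_tree S \<Longrightarrow> l e = 0" for e
      using l by (auto simp: transport_def simp del: split_paired_All)
    ultimately have k: "real (nat \<lfloor>l e\<rfloor>) = l e" for e
      by (metis Ints_cases floor_of_int of_int_0_le_iff of_nat_nat)
    have "transport (simplex_tree S) a b (\<lambda>e. nat \<lfloor>l e\<rfloor>)"
      unfolding transport_def
    proof (intro conjI allI impI)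
      fix x
      have "real (\<Sum>y\<in>UNIV. nat \<lfloor>l (x, y)\<rfloor>) = real (a x)"
        using l unfolding of_nat_sum k by (simp add: transport_def)
      then show "(\<Sum>y\<in>UNIV. nat \<lfloor>l (x, y)\<rfloor>) = a x" by (simp only: of_nat_eq_iff)
    next
      fix y
      have "real (\<Sum>x\<in>UNIV. nat \<lfloor>l (x, y)\<rfloor>) = real (b y)"
        using l unfolding of_nat_sum k by (simp add: transport_def)
      then show "(\<Sum>x\<in>UNIV. nat \<lfloor>l (x, y)\<rfloor>) = b y" by (simp only: of_nat_eq_iff)
    qed (simp_all add: zero)
    then show ?thesis using S by (intro bexI exI) auto
  qed
qed

lemma pointed_tree_extension: "pointed_tree F = pointed_extension Inl Inr F"
  by (simp add: pointed_tree_def pointed_extension_def)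

lemma swapped_pointed_tree_extension: "swapped_pointed_tree F = pointed_extension Inr Inl (F\<inverse>)"
  unfolding swapped_pointed_tree_def pointed_extension_def by blast

lemma sum_partition: "range Inl \<inter> range Inr = {}" "range Inl \<union> range Inr = UNIV"
  "range Inr \<inter> range Inl = {}" "range Inr \<union> range Inl = UNIV"
  by (auto simp: UNIV_sum)

lemma pointed_tree_family:
  assumes "product_triangulation T"
  shows "matching_family ((\<lambda>S. pointed_tree (simplex_tree S)) ` T)"
  using pointed_extension_matching_family[OF triangulation_tree_family[OF assms] inj_Inl inj_Inr sum_partition(1,2)]
  by (simp add: pointed_tree_extension image_image)

lemma swapped_pointed_tree_family:
  assumes "product_triangulation T"
  shows "matching_family ((\<lambda>S. swapped_pointed_tree (simplex_tree S)) ` T)"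
  using pointed_extension_matching_family[OF tree_family_converse[OF triangulation_tree_family[OF assms]] inj_Inr inj_Inl sum_partition(3,4)]
  by (simp add: swapped_pointed_tree_extension image_image)

section \<open>Signs of orderings split into two blocks\<close>

lemma inversion_sign_append:
  assumes "distinct (us @ vs)"
  shows "inversion_sign (us @ vs) = inversion_sign us * inversion_sign vs * (\<Prod>u\<in>set us. \<Prod>v\<in>set vs. order_sgn u v)"
  using assms
proof (induction us)
  case (Cons u us)
  then have "(\<Prod>y\<in>set us \<union> set vs. order_sgn u y) = (\<Prod>y\<in>set us. order_sgn u y) * (\<Prod>y\<in>set vs. order_sgn u y)"
    by (intro prod.union_disjoint) auto
  with Cons show ?case by (simp add: mult_ac)
qed simp

text \<open>The inversions between the two blocks depend only on the underlying sets, so they cancel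
  when two orderings with the same blocks are compared.\<close>

lemma ordering_sign_append:
  assumes "distinct (us @ vs)" "distinct (us' @ vs')" "set us' = set us" "set vs' = set vs"
  shows "ordering_sign us * ordering_sign us' * (ordering_sign vs * ordering_sign vs')
      = ordering_sign (us @ vs) * ordering_sign (us' @ vs')"
proof -
  define X where "X = (\<Prod>u\<in>set us. \<Prod>v\<in>set vs. order_sgn u v)"
  have "X \<in> {-1, 1}" unfolding X_def by (intro sign_prod order_sgn_sign)
  then have "X * X = 1" by (rule sign_square)
  moreover have "ordering_sign (us @ vs) = ordering_sign us * ordering_sign vs * X"
    "ordering_sign (us' @ vs') = ordering_sign us' * ordering_sign vs' * X"
    using inversion_sign_append[OF assms(1)] inversion_sign_append[OF assms(2)] assms
    by (simp_all add: ordering_sign_inversion X_def)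
  ultimately show ?thesis by (simp add: algebra_simps)
qed

lemma ordering_sign_map_transpose:
  assumes xs: "distinct xs" and ab: "a \<in> set xs" "b \<in> set xs" "a \<noteq> b"
  shows "ordering_sign (map (Transposition.transpose a b) xs) = - ordering_sign xs"
proof -
  obtain k l where kl: "k < length xs" "xs ! k = a" "l < length xs" "xs ! l = b"
    using ab(1,2) unfolding in_set_conv_nth by metis
  then have "k \<noteq> l" using ab(3) by auto
  have \<pi>: "Transposition.transpose k l permutes {..<length xs}"
    using kl by (intro permutes_swap_id) auto
  have "map (Transposition.transpose a b) xs = permute_list (Transposition.transpose k l) xs"
  proof (rule nth_equalityI)
    fix i assume "i < length (map (Transposition.transpose a b) xs)"
    then have i: "i < length xs" by simp
    have "xs ! i = a \<longleftrightarrow> i = k" "xs ! i = b \<longleftrightarrow> i = l"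
      using kl i xs nth_eq_iff_index_eq by metis+
    then show "map (Transposition.transpose a b) xs ! i = permute_list (Transposition.transpose k l) xs ! i"
      using permute_list_nth[OF \<pi> i] i kl by (simp add: Transposition.transpose_def)
  qed simp
  then show ?thesis
    using ordering_sign_permute[OF xs \<pi>] \<open>k \<noteq> l\<close> by (simp add: sign_swap_id)
qed

text \<open>If \<open>\<mu>\<close> is injective on \<open>I\<close>, the involution of
  \<open>V\<close> that interchanges the copy of \<open>r\<close> with the column
  \<open>\<mu> r\<close> for each \<open>r\<close> in \<open>I\<close>.\<close>

definition swap_along :: "('r \<Rightarrow> 'e) \<Rightarrow> 'r set \<Rightarrow> 'r + 'e \<Rightarrow> 'r + 'e" where
  "swap_along \<mu> I v = (case v of Inl r \<Rightarrow> if r \<in> I then Inr (\<mu> r) else Inl r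
     | Inr e \<Rightarrow> if e \<in> \<mu> ` I then Inl (inv_into I \<mu> e) else Inr e)"

lemma swap_along_simps:
  "swap_along \<mu> I (Inl r) = (if r \<in> I then Inr (\<mu> r) else Inl r)"
  "swap_along \<mu> I (Inr e) = (if e \<in> \<mu> ` I then Inl (inv_into I \<mu> e) else Inr e)"
  by (simp_all add: swap_along_def)

lemma swap_along_involution:
  assumes "inj_on \<mu> I" shows "swap_along \<mu> I (swap_along \<mu> I v) = v"
proof (cases v)
  case (Inl r)
  then show ?thesis using assms by (simp add: swap_along_simps)
next
  case (Inr e)
  then show ?thesis using inv_into_into[of e \<mu> I] f_inv_into_f[of e \<mu> I] by (simp add: swap_along_simps)
qed

lemma swap_along_insert:
  assumes "inj_on \<mu> (insert i I)" "i \<notin> I"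
  shows "swap_along \<mu> (insert i I) = Transposition.transpose (Inl i) (Inr (\<mu> i)) \<circ> swap_along \<mu> I"
proof
  fix v
  have ni: "\<mu> r \<noteq> \<mu> i" if "r \<in> I" for r using assms that by (auto simp: inj_on_def)
  have inj: "inj_on \<mu> I" using assms(1) by simp
  show "swap_along \<mu> (insert i I) v = (Transposition.transpose (Inl i) (Inr (\<mu> i)) \<circ> swap_along \<mu> I) v"
  proof (cases v)
    case (Inl r)
    then show ?thesis using assms(2) ni[of r] by (auto simp: swap_along_simps Transposition.transpose_def)
  next
    case (Inr e)
    consider "e = \<mu> i" | r where "r \<in> I" "e = \<mu> r" | "e \<notin> \<mu> ` insert i I" by blast
    then show ?thesis
    proof cases
      case 1
      have "inv_into (insert i I) \<mu> (\<mu> i) = i" by (rule inv_into_f_f[OF assms(1)]) simp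
      moreover have "\<mu> i \<notin> \<mu> ` I" using ni by force
      ultimately show ?thesis by (simp add: Inr 1 swap_along_simps)
    next
      case 2
      have "inv_into (insert i I) \<mu> (\<mu> r) = r" by (rule inv_into_f_f[OF assms(1)]) (simp add: 2)
      moreover have "inv_into I \<mu> (\<mu> r) = r" by (rule inv_into_f_f[OF inj 2(1)])
      moreover have "r \<noteq> i" using 2 assms(2) by blast
      ultimately show ?thesis using 2(1) by (simp add: Inr 2 swap_along_simps Transposition.transpose_def)
    next
      case 3
      then show ?thesis by (simp add: Inr swap_along_simps Transposition.transpose_def)
    qed
  qed
qed

text \<open>The copies followed by the columns form the increasing list of \<open>V\<close>, and
  each element of \<open>I\<close> contributes one transposition, disjoint from the others.\<close>

lemma ordering_sign_swap_along:
  fixes \<mu> :: "'r::{finite,linorder} \<Rightarrow> 'e::{finite,linorder}"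
  assumes "inj_on \<mu> I"
  shows "ordering_sign (map (swap_along \<mu> I) (map Inl enum @ map Inr enum)) = (-1) ^ card I"
proof -
  let ?ss = "map Inl enum @ map Inr enum :: ('r + 'e) list"
  have ss: "distinct ?ss" "set ?ss = UNIV" by (auto simp: distinct_map UNIV_sum)
  have "finite I" by simp
  then show ?thesis using assms
  proof (induction I)
    case empty
    have "swap_along \<mu> {} = id" by (auto simp: swap_along_def fun_eq_iff split: sum.split)
    moreover have "sorted ?ss"
      by (auto simp: sorted_append sorted_map less_eq_sum_def)
    ultimately show ?case
      using inversion_sign_sorted[of ?ss] ss(1) by (simp add: ordering_sign_inversion del: map_append)
  next
    case (insert i I)
    have inj: "inj_on \<mu> I" using insert.prems by simp
    then have bij: "inj (swap_along \<mu> I)" "surj (swap_along \<mu> I)"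
      using swap_along_involution[OF inj] by (metis injI, metis surjI)
    have "distinct (map (swap_along \<mu> I) ?ss)"
      using ss(1) bij(1) unfolding distinct_map by (metis inj_on_subset subset_UNIV)
    moreover have "set (map (swap_along \<mu> I) ?ss) = UNIV"
      using ss(2) bij(2) by (simp del: map_append)
    ultimately have "ordering_sign (map (Transposition.transpose (Inl i) (Inr (\<mu> i))) (map (swap_along \<mu> I) ?ss))
        = - ordering_sign (map (swap_along \<mu> I) ?ss)"
      by (intro ordering_sign_map_transpose) auto
    then show ?case
      using insert.IH[OF inj] insert.hyps unfolding swap_along_insert[OF insert.prems insert.hyps(2)]
      by (simp add: o_def del: map_append)
  qed
qed

lemma perfect_matching_graph:
  assumes "inj f" shows "perfect_matching UNIV (range f) (range (\<lambda>q. (q, f q)))"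
  using assms by (auto simp: perfect_matching_def inj_eq)

lemma matching_sign_graph: "matching_sign (range (\<lambda>q. (q, f q))) = ordering_sign (map f enum)"
  unfolding matching_sign_def
  by (rule arg_cong[where f = ordering_sign]) auto

lemma prod_graph: "(\<Prod>(q, v)\<in>range (\<lambda>q. (q, f q)). h q v) = (\<Prod>q\<in>UNIV. h q (f q))"
  by (subst prod.reindex) (auto intro: injI)

text \<open>Rows whose copy lies in \<open>\<sigma>\<close> are matched to it, being its only
  neighbours; the others, collected in \<open>I\<close>, use tree edges. Read backwards, these edges
  match the columns in \<open>\<sigma>\<close> to the copies outside \<open>\<sigma>\<close>, while
  every other column is matched to itself. So one involution describes both matchings.\<close>

lemma dual_matchings:
  fixes T :: "((real ^ 'r::{finite,linorder}) \<times> (real ^ 'e::{finite,linorder})) set set"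
  assumes T: "product_triangulation T" and card: "card \<sigma> = CARD('r)"
  obtains \<mu> I where "inj_on \<mu> I" "range (\<lambda>r. swap_along \<mu> I (Inl r)) = \<sigma>" "range (\<lambda>e. swap_along \<mu> I (Inr e)) = - \<sigma>"
    "pointed_matching_field T \<sigma> = range (\<lambda>r. (r, swap_along \<mu> I (Inl r)))"
    "swapped_pointed_matching_field T (- \<sigma>) = range (\<lambda>e. (e, swap_along \<mu> I (Inr e)))"
proof -
  note fam = pointed_tree_family[OF T] and fam' = swapped_pointed_tree_family[OF T]
  define M where "M = pointed_matching_field T \<sigma>"
  have pm: "perfect_matching UNIV \<sigma> M" and "\<exists>S\<in>T. M \<subseteq> pointed_tree (simplex_tree S)"
    unfolding M_def pointed_matching_field_def using matching_family.matching_field[OF fam card] by auto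
  then obtain S where S: "S \<in> T" "M \<subseteq> pointed_tree (simplex_tree S)" by blast
  obtain m where m: "\<And>q v. (q, v) \<in> M \<longleftrightarrow> v = m q"
  proof -
    have ex: "\<exists>!v. (q, v) \<in> M" for q using pm by (simp add: perfect_matching_def)
    have "(q, THE v. (q, v) \<in> M) \<in> M" for q by (rule theI'[OF ex])
    then have "(q, v) \<in> M \<longleftrightarrow> v = (THE v. (q, v) \<in> M)" for q v using ex[of q] by (metis (no_types))
    then show thesis by (rule that)
  qed
  have mem: "m q \<in> \<sigma>" for q using pm m[of q "m q"] by (auto simp: perfect_matching_def)
  have inj: "inj m"
  proof (rule injI)
    fix p q assume "m p = m q"
    moreover have "\<exists>!q. (q, m p) \<in> M" using pm mem[of p] by (simp add: perfect_matching_def)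
    ultimately show "p = q" unfolding m by (metis (no_types))
  qed
  have sub: "(q, m q) \<in> pointed_tree (simplex_tree S)" for q using S(2) m by blast
  have surj: "range m = \<sigma>"
  proof
    show "range m \<subseteq> \<sigma>" using mem by blast
    show "\<sigma> \<subseteq> range m"
    proof
      fix v assume "v \<in> \<sigma>"
      then have "\<exists>!q. (q, v) \<in> M" using pm by (simp add: perfect_matching_def)
      then obtain q where "(q, v) \<in> M" by blast
      then show "v \<in> range m" using m by simp
    qed
  qed
  define I where "I = {r. Inl r \<notin> \<sigma>}"
  \<comment> \<open>Outside \<open>I\<close> the partner is a copy and \<open>projr\<close> is
    unspecified; \<open>swap_along\<close> reads \<open>\<mu>\<close> only on
    \<open>I\<close>.\<close>
  define \<mu> where "\<mu> r = projr (m r)" for r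
  have out: "m r = Inl r" if "r \<notin> I" for r
  proof -
    have "Inl r \<in> range m" using that unfolding surj I_def by simp
    then obtain q where q: "m q = Inl r" by (metis imageE)
    then show ?thesis using sub[of q] by (auto simp: pointed_tree_def)
  qed
  have ins: "m r = Inr (\<mu> r) \<and> (r, \<mu> r) \<in> simplex_tree S" if "r \<in> I" for r
    using sub[of r] mem[of r] that by (auto simp: pointed_tree_def \<mu>_def I_def)
  have \<mu>: "inj_on \<mu> I"
    using inj ins by (metis inj_onI inj_eq)
  let ?\<theta> = "swap_along \<mu> I"
  have m_eq: "?\<theta> (Inl r) = m r" for r
    using ins[of r] out[of r] by (cases "r \<in> I") (simp_all add: swap_along_simps)
  have range_l: "range (\<lambda>r. ?\<theta> (Inl r)) = \<sigma>" unfolding m_eq by (rule surj)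
  have inj\<theta>: "inj ?\<theta>" and surj\<theta>: "surj ?\<theta>"
    using swap_along_involution[OF \<mu>] by (metis injI, metis surjI)
  have range_r: "range (\<lambda>e. ?\<theta> (Inr e)) = - \<sigma>"
  proof -
    have "range (\<lambda>e. ?\<theta> (Inr e)) = ?\<theta> ` range Inr" by (simp add: image_image)
    also have "range (Inr :: 'e \<Rightarrow> 'r + 'e) = - range Inl" by (auto simp: image_iff) (metis sum.exhaust)
    also have "?\<theta> ` (- range Inl) = - (?\<theta> ` range Inl)" by (rule bij_image_Compl_eq) (simp add: bij_def inj\<theta> surj\<theta>)
    also have "?\<theta> ` range Inl = \<sigma>" using range_l by (simp add: image_image)
    finally show ?thesis .
  qed
  have M_eq: "M = range (\<lambda>r. (r, ?\<theta> (Inl r)))"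
    unfolding m_eq using m by (auto simp: image_iff)
  \<comment> \<open>The second matching lies in the swapped tree of the same simplex
    \<open>S\<close>; uniqueness in the swapped family then identifies it.\<close>
  have tree: "range (\<lambda>e. (e, ?\<theta> (Inr e))) \<subseteq> swapped_pointed_tree (simplex_tree S)"
  proof -
    have "(e, ?\<theta> (Inr e)) \<in> swapped_pointed_tree (simplex_tree S)" for e
    proof (cases "e \<in> \<mu> ` I")
      case True
      then have "inv_into I \<mu> e \<in> I" "\<mu> (inv_into I \<mu> e) = e" by (auto intro: inv_into_into f_inv_into_f)
      then have "(inv_into I \<mu> e, e) \<in> simplex_tree S" using ins by metis
      then show ?thesis using True by (auto simp: swapped_pointed_tree_def swap_along_simps)
    qed (simp add: swapped_pointed_tree_def swap_along_simps)
    then show ?thesis by blast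
  qed
  have injr: "inj (\<lambda>e. ?\<theta> (Inr e))" using inj_compose[OF inj\<theta> inj_Inr] by (simp add: o_def)
  have "swapped_pointed_matching_field T (- \<sigma>) = range (\<lambda>e. (e, ?\<theta> (Inr e)))"
    unfolding swapped_pointed_matching_field_def
    by (rule matching_family.matching_field_eqI[OF fam' perfect_matching_graph[OF injr, unfolded range_r] imageI[OF S(1)] tree])
  then show thesis using that[OF \<mu> range_l range_r M_eq[unfolded M_def]] by blast
qed

lemma hcat_nth: "hcat X Y $ q $ Inl c = X $ q $ c" "hcat X Y $ q $ Inr d = Y $ q $ d"
  by (simp_all add: hcat_def)

lemma uminus_vec_nth2: "(- X) $ i $ j = - (X $ i $ j)" for X :: "int ^ 'a::finite ^ 'b::finite"
  by simp

text \<open>The involution has sign \<open>(-1) ^ card I\<close>. The entries of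
  \<open>- transpose A\<close> supply the same power, and every entry of \<open>A\<close> involved
  occurs twice.\<close>

lemma dual_signs:
  fixes T :: "((real ^ 'r::{finite,linorder}) \<times> (real ^ 'e::{finite,linorder})) set set"
    and A :: "int ^ 'e::{finite,linorder} ^ 'r::{finite,linorder}"
  assumes T: "product_triangulation T" and A: "\<forall>i j. A $ i $ j \<in> {-1, 1}"
    and xs: "distinct (us @ vs)" "set us \<union> set vs = UNIV" "length us = CARD('r)"
  shows "induced_chirotope (pointed_matching_field T) (hcat (mat 1) A) us *
      induced_chirotope (swapped_pointed_matching_field T) (hcat (- transpose A) (mat 1)) vs = ordering_sign (us @ vs)"
proof -
  have card: "card (set us) = CARD('r)" using xs by (simp add: distinct_card)
  obtain \<mu> I where \<mu>: "inj_on \<mu> I"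
    and range: "range (\<lambda>r. swap_along \<mu> I (Inl r)) = set us" "range (\<lambda>e. swap_along \<mu> I (Inr e)) = - set us"
    and M: "pointed_matching_field T (set us) = range (\<lambda>r. (r, swap_along \<mu> I (Inl r)))"
    and N: "swapped_pointed_matching_field T (- set us) = range (\<lambda>e. (e, swap_along \<mu> I (Inr e)))"
    by (rule dual_matchings[OF T card])
  have vs: "set vs = - set us" using xs by auto
  \<comment> \<open>The partners of all rows, then those of all columns: the ordering of
    \<open>V\<close> with which \<open>us @ vs\<close> is compared, block by block.\<close>
  define L where "L = map (\<lambda>r. swap_along \<mu> I (Inl r)) (enum :: 'r list)"
  define L' where "L' = map (\<lambda>e. swap_along \<mu> I (Inr e)) (enum :: 'e list)"
  have LL: "L @ L' = map (swap_along \<mu> I) (map Inl enum @ map Inr enum)"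
    by (simp add: L_def L'_def)
  have "inj (swap_along \<mu> I)" using swap_along_involution[OF \<mu>] by (metis injI)
  then have dist: "distinct (L @ L')"
    unfolding LL distinct_map[of "swap_along \<mu> I"] by (auto simp: distinct_map intro: inj_on_subset)
  have os: "ordering_sign (L @ L') = (-1) ^ card I"
    unfolding LL by (rule ordering_sign_swap_along[OF \<mu>])
  have "(\<Prod>r\<in>UNIV. hcat (mat 1) A $ r $ swap_along \<mu> I (Inl r)) = (\<Prod>r\<in>UNIV. if r \<in> I then A $ r $ \<mu> r else 1)"
    by (intro prod.cong) (auto simp: swap_along_simps hcat_nth mat_def)
  also have "\<dots> = (\<Prod>r\<in>I. A $ r $ \<mu> r)" by (simp add: prod.If_cases)
  finally have prod1: "(\<Prod>r\<in>UNIV. hcat (mat 1) A $ r $ swap_along \<mu> I (Inl r)) = (\<Prod>r\<in>I. A $ r $ \<mu> r)" .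
  \<comment> \<open>The same edges \<open>(r, \<mu> r)\<close>, now as entries of
    \<open>- transpose A\<close>, give one extra sign per element of \<open>I\<close>.\<close>
  have "(\<Prod>e\<in>UNIV. hcat (- transpose A) (mat 1) $ e $ swap_along \<mu> I (Inr e))
      = (\<Prod>e\<in>UNIV. if e \<in> \<mu> ` I then - (A $ inv_into I \<mu> e $ e) else 1)"
    by (intro prod.cong) (auto simp: swap_along_simps hcat_nth mat_def uminus_vec_nth2 transpose_def)
  also have "\<dots> = (\<Prod>e\<in>\<mu> ` I. - (A $ inv_into I \<mu> e $ e))" by (simp add: prod.If_cases)
  also have "\<dots> = (\<Prod>r\<in>I. - (A $ r $ \<mu> r))"
    using \<mu> by (simp add: prod.reindex inv_into_f_f)
  also have "\<dots> = (-1) ^ card I * (\<Prod>r\<in>I. A $ r $ \<mu> r)" by (simp add: prod_uminus)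
  finally have prod2: "(\<Prod>e\<in>UNIV. hcat (- transpose A) (mat 1) $ e $ swap_along \<mu> I (Inr e))
      = (-1) ^ card I * (\<Prod>r\<in>I. A $ r $ \<mu> r)" .
  have "(\<Prod>r\<in>I. A $ r $ \<mu> r) \<in> {-1, 1}" by (rule sign_prod) (use A in blast)
  then have sq: "(\<Prod>r\<in>I. A $ r $ \<mu> r) * (\<Prod>r\<in>I. A $ r $ \<mu> r) = 1" by (rule sign_square)
  have app: "ordering_sign us * ordering_sign L * (ordering_sign vs * ordering_sign L') = ordering_sign (us @ vs) * (-1) ^ card I"
  proof -
    have "set L = set us" "set L' = set vs" using range vs by (simp_all add: L_def L'_def)
    then show ?thesis using ordering_sign_append[OF xs(1) dist] by (simp add: os)
  qed
  have "induced_chirotope (pointed_matching_field T) (hcat (mat 1) A) us *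
      induced_chirotope (swapped_pointed_matching_field T) (hcat (- transpose A) (mat 1)) vs
    = (ordering_sign us * ordering_sign L * (ordering_sign vs * ordering_sign L')) * ((-1) ^ card I * ((\<Prod>r\<in>I. A $ r $ \<mu> r) * (\<Prod>r\<in>I. A $ r $ \<mu> r)))"
    using xs(1) unfolding induced_chirotope_def vs M N matching_sign_graph prod_graph prod1 prod2
    by (simp add: L_def L'_def mult_ac)
  then show ?thesis
    unfolding app sq by (simp add: mult.assoc power_add[symmetric])
qed

theorem proposition3p17:
  fixes T :: "((real ^ 'r::{finite,linorder}) \<times> (real ^ 'e::{finite,linorder})) set set"
    and A :: "int ^ 'e::{finite,linorder} ^ 'r::{finite,linorder}"
  assumes "product_triangulation T"
    and "\<forall>i j. A $ i $ j \<in> {-1, 1}"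
  shows "dual_uniform_chirotopes CARD('r) CARD('e)
           (induced_chirotope (pointed_matching_field T) (hcat (mat 1) A))
           (induced_chirotope (swapped_pointed_matching_field T) (hcat (- transpose A) (mat 1)))"
proof -
  have A: "A $ i $ j = -1 \<or> A $ i $ j = 1" "A $ i $ j = 1 \<or> A $ i $ j = -1" for i j using assms(2) by blast+
  \<comment> \<open>The zeros of the identity block sit at pairs of a row and the copy of a
    different row, which are never edges of a pointed tree.\<close>
  have "hcat (mat 1) A $ q $ v \<in> {-1, 1}" if "(q, v) \<in> pointed_tree F" for q v F
  proof -
    from that consider "v = Inl q" | j where "v = Inr j" unfolding pointed_tree_def by blast
    then show ?thesis by cases (simp_all add: hcat_nth mat_def A)
  qed
  then have "uniform_chirotope CARD('r) (induced_chirotope (pointed_matching_field T) (hcat (mat 1) A))"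
    unfolding pointed_matching_field_def
    by (intro uniform_chirotope_family[OF pointed_tree_family[OF assms(1)]]) auto
  moreover have "hcat (- transpose A) (mat 1) $ q $ v \<in> {-1, 1}" if "(q, v) \<in> swapped_pointed_tree F" for q v F
  proof -
    from that consider "v = Inr q" | i where "v = Inl i" unfolding swapped_pointed_tree_def by blast
    then show ?thesis by cases (simp_all add: hcat_nth mat_def uminus_vec_nth2 transpose_def minus_equation_iff[of _ 1] A)
  qed
  then have "uniform_chirotope CARD('e) (induced_chirotope (swapped_pointed_matching_field T) (hcat (- transpose A) (mat 1)))"
    unfolding swapped_pointed_matching_field_def
    by (intro uniform_chirotope_family[OF swapped_pointed_tree_family[OF assms(1)]]) auto
  moreover have "induced_chirotope (pointed_matching_field T) (hcat (mat 1) A) (take CARD('r) xs) *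
      induced_chirotope (swapped_pointed_matching_field T) (hcat (- transpose A) (mat 1)) (drop CARD('r) xs) = ordering_sign xs"
    if xs: "distinct xs" "set xs = UNIV" for xs
  proof -
    have "length xs = CARD('r) + CARD('e)" using distinct_card[OF xs(1)] xs(2) by simp
    then have "length (take CARD('r) xs) = CARD('r)" by simp
    moreover have "set (take CARD('r) xs) \<union> set (drop CARD('r) xs) = UNIV"
      using xs(2) by (metis append_take_drop_id set_append)
    ultimately show ?thesis
      using dual_signs[OF assms, of "take CARD('r) xs" "drop CARD('r) xs"] xs(1) by simp
  qed
  ultimately show ?thesis by (simp add: dual_uniform_chirotopes_def)
qed

end
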